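(* Let $d\ge2$, $c>0$, and let $k^{\mathrm{Lap}}(\mathbf{x},\mathbf{z})=e^{-c\sqrt{1-\mathbf{x}^T\mathbf{z}}}$ for $\mathbf{x},\mathbf{z}\in\mathbb{S}^{d-1}$ (the Laplace kernel restricted to the sphere). Then $k^{\mathrm{Lap}}(\mathbf{x},\mathbf{z})=\sum_{k\ge0}\lambda_k\sum_{j=1}^{N(d,k)}Y_{k,j}(\mathbf{x})Y_{k,j}(\mathbf{z})$ with $\lambda_k>0$ for all $k\ge0$, and there exist $k_0$ and constants $B_1,B_2>0$ depending on $d$ and $c$ such that for all $k>k_0$, $B_1k^{-d}\le\lambda_k\le B_2k^{-d}$.
   Context: $\{Y_{k,j}\}_{j=1}^{N(d,k)}$ is an orthonormal basis (in $L^2$ of the uniform surface measure on $\mathbb{S}^{d-1}$) of the space of spherical harmonics of degree $k$; the $\lambda_k$ are the Mercer eigenvalues of the zonal kernel with respect to the uniform measure on $\mathbb{S}^{d-1}$. *)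

theory Defs
  imports "HOL-Analysis.Analysis"
begin

text \<open>Points of R^d are vectors of type real^'n with d = CARD('n).
  The unit sphere S^{d-1} is sphere 0 1.\<close>

text \<open>Uniform (unnormalized) surface measure on the sphere, via the cone construction:
  sigma(A) = d * Lebesgue volume of {t a | 0 < t < 1, a in A}.
  Realised as the pushforward of d times Lebesgue measure on the punctured unit ball
  under radial projection x -> x / |x|.\<close>
definition sphere_measure :: "(real^'n) measure" where
  "sphere_measure =
     distr (density lborel (\<lambda>x. ennreal (real CARD('n)) * indicator (ball 0 1 - {0}) x))
           borel (\<lambda>x. x /\<^sub>R norm x)"

definition lap_kernel :: "real \<Rightarrow> real^'n \<Rightarrow> real^'n \<Rightarrow> real" where
  "lap_kernel c x z = exp (- c * sqrt (1 - x \<bullet> z))"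

definition partial_deriv :: "'n::finite \<Rightarrow> (real^'n \<Rightarrow> real) \<Rightarrow> real^'n \<Rightarrow> real" where
  "partial_deriv i f x = deriv (\<lambda>t. f (x + t *\<^sub>R axis i 1)) 0"

definition laplacian :: "(real^'n::finite \<Rightarrow> real) \<Rightarrow> real^'n \<Rightarrow> real" where
  "laplacian f x = (\<Sum>i\<in>UNIV. partial_deriv i (partial_deriv i f) x)"

definition homogeneous_poly :: "nat \<Rightarrow> (real^'n::finite \<Rightarrow> real) \<Rightarrow> bool" where
  "homogeneous_poly k f \<longleftrightarrow>
     (\<exists>c :: ('n \<Rightarrow> nat) \<Rightarrow> real. \<forall>x.
        f x = (\<Sum>\<alpha>\<in>{\<alpha>. sum \<alpha> UNIV = k}. c \<alpha> * (\<Prod>i\<in>UNIV. (x $ i) ^ (\<alpha> i))))"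

definition sph_harm :: "nat \<Rightarrow> (real^'n::finite \<Rightarrow> real) set" where
  "sph_harm k = {f. homogeneous_poly k f \<and> (\<forall>x. laplacian f x = 0)}"

definition sph_harm_onb :: "nat \<Rightarrow> nat \<Rightarrow> (nat \<Rightarrow> real^'n::finite \<Rightarrow> real) \<Rightarrow> bool" where
  "sph_harm_onb k N Y \<longleftrightarrow>
     (\<forall>j<N. Y j \<in> sph_harm k) \<and>
     (\<forall>i<N. \<forall>j<N. (LINT x|sphere_measure. Y i x * Y j x) = (if i = j then 1 else 0)) \<and>
     (\<forall>f\<in>sph_harm k. \<exists>a. \<forall>x\<in>sphere 0 1. f x = (\<Sum>j<N. a j * Y j x))"

definition mercer_eigenvalue :: "(real^'n::finite \<Rightarrow> real^'n \<Rightarrow> real) \<Rightarrow> nat \<Rightarrow> real \<Rightarrow> bool" where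
  "mercer_eigenvalue K k lam \<longleftrightarrow>
     (\<forall>Y\<in>sph_harm k. \<forall>x\<in>sphere 0 1. (LINT z|sphere_measure. K x z * Y z) = lam * Y x)"

end

theory Submission
  imports Defs
begin

text \<open>
  The Taylor coefficients \<open>a\<^sub>n\<close> of \<open>exp (- c * sqrt (1 - t))\<close> at \<open>0\<close> are positive, summable, and up to
  constants equal to those of \<open>- sqrt (1 - t)\<close>: this follows from the linear recursion they satisfy.
  For the kernel \<open>(x \<bullet> z) ^ n\<close> the eigenvalue \<open>\<mu>\<^sub>n\<^sub>,\<^sub>k\<close> on spherical harmonics of degree \<open>k\<close> is
  nonnegative and explicit; it is found by integrating polynomials by parts over the sphere.
  Hence \<open>\<lambda>\<^sub>k = (\<Sum>n. a\<^sub>n * \<mu>\<^sub>n\<^sub>,\<^sub>k) > 0\<close>, and \<open>\<lambda>\<^sub>k\<close> is comparable to the same sum formed with the coefficients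
  of \<open>- sqrt (1 - t)\<close>. That sum satisfies a first-order recursion in \<open>k\<close> (creative telescoping), which
  makes it a constant over \<open>(k - 1/2) (k + 1/2) \<dots> (k + d - 3/2)\<close>, of order \<open>k\<close> to the power \<open>- d\<close>.
\<close>

subsection \<open>Homogeneous polynomials\<close>

text \<open>The eigenvalues depend monotonically on the Taylor coefficients because every
  \<open>\<mu>\<^sub>n\<^sub>,\<^sub>k\<close> is nonnegative, so two-sided bounds on the
  coefficients suffice and no asymptotic formula for them is needed. The reference function is
  dictated by the singularity at t = 1, where exp (- c * sqrt (1 - t)) behaves like 1 - c * sqrt (1
  - t). The constant terms are not compared: n = 0 contributes only to degree k = 0. The sphere
  carries nothing but a pushforward of Lebesgue measure on the ball. Integration by parts therefore
  starts in R^d with a C^1 cutoff, where the integral of a derivative vanishes, and homogeneity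
  turns each ball integral into a multiple of a sphere integral. The pointwise expansion does not
  follow from the eigenvalue equation alone. For each power of \<open>x \<bullet> z\<close> it is
  finite and exact, since on the sphere such a power is a combination of zonal harmonics; summing
  over n then amounts to exchanging two series.\<close>

inductive hpoly :: "nat \<Rightarrow> (real^'n::finite \<Rightarrow> real) \<Rightarrow> bool" where
  const: "hpoly 0 (\<lambda>_. a)"
| coord: "hpoly k f \<Longrightarrow> hpoly (Suc k) (\<lambda>z. z $ i * f z)"
| zero: "hpoly k (\<lambda>_. 0)"
| add: "hpoly k f \<Longrightarrow> hpoly k g \<Longrightarrow> hpoly k (\<lambda>z. f z + g z)"

lemma hpoly_cmult: "hpoly k f \<Longrightarrow> hpoly k (\<lambda>z. a * f z)"
proof (induction rule: hpoly.induct)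
  case (coord k f i)
  show ?case using hpoly.coord[OF coord.IH, of i] by (simp add: mult.left_commute)
qed (auto intro: hpoly.intros simp: distrib_left)

lemma hpoly_sum: "finite I \<Longrightarrow> (\<And>i. i \<in> I \<Longrightarrow> hpoly k (f i)) \<Longrightarrow> hpoly k (\<lambda>z. \<Sum>i\<in>I. f i z)"
  by (induction I rule: finite_induct) (auto intro: hpoly.intros)

lemma hpoly_mult: "hpoly k f \<Longrightarrow> hpoly l g \<Longrightarrow> hpoly (k + l) (\<lambda>z. f z * g z)"
proof (induction rule: hpoly.induct)
  case (coord k f i)
  then show ?case using hpoly.coord[of "k + l" "\<lambda>z. f z * g z" i] by (simp add: mult.assoc)
qed (auto intro: hpoly.intros hpoly_cmult simp: distrib_right)

lemma hpoly_inner: "hpoly 1 (\<lambda>z. x \<bullet> z)"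
proof -
  have "hpoly (Suc 0) (\<lambda>z. \<Sum>i\<in>UNIV. x $ i * (z $ i * 1))"
    by (intro hpoly_sum hpoly_cmult hpoly.coord hpoly.const) auto
  then show ?thesis by (simp add: inner_vec_def)
qed

lemma hpoly_norm_sq: "hpoly 2 (\<lambda>z :: real^'n::finite. (norm z)\<^sup>2)"
proof -
  have "hpoly (Suc (Suc 0)) (\<lambda>z :: real^'n. \<Sum>i\<in>UNIV. z $ i * (z $ i * 1))"
    by (intro hpoly_sum hpoly.coord hpoly.const) auto
  moreover have "(\<Sum>i\<in>UNIV. z $ i * (z $ i * 1)) = (norm z)\<^sup>2" for z :: "real^'n"
    by (simp add: power2_norm_eq_inner inner_vec_def)
  ultimately show ?thesis by (simp add: numeral_2_eq_2)
qed

lemma hpoly_power: "hpoly k f \<Longrightarrow> hpoly (n * k) (\<lambda>z. f z ^ n)"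
  by (induction n) (auto intro: hpoly.intros hpoly_mult)

lemma finite_multiindices: "finite {\<alpha> :: 'n::finite \<Rightarrow> nat. sum \<alpha> UNIV = k}"
proof (rule finite_subset)
  have "\<alpha> i \<le> sum \<alpha> UNIV" for \<alpha> :: "'n \<Rightarrow> nat" and i
    by (rule member_le_sum) auto
  then show "{\<alpha> :: 'n \<Rightarrow> nat. sum \<alpha> UNIV = k} \<subseteq> Pi\<^sub>E UNIV (\<lambda>_. {..k})" by auto
qed (auto intro: finite_PiE)

text \<open>A monomial of positive degree has a variable with nonzero exponent; splitting off one
  such factor leaves the monomial with exponents \<open>\<beta>\<close>, one degree lower.\<close>

lemma hpoly_monomial:
  "sum \<alpha> (UNIV :: 'n::finite set) = k \<Longrightarrow> hpoly k (\<lambda>z. \<Prod>i\<in>UNIV. (z $ i) ^ \<alpha> i)"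
proof (induction k arbitrary: \<alpha>)
  case 0
  then show ?case using hpoly.const[of 1] by simp
next
  case (Suc k)
  then obtain j where j: "\<alpha> j \<noteq> 0" by fastforce
  define \<beta> where "\<beta> = \<alpha>(j := \<alpha> j - 1)"
  have s: "sum \<gamma> UNIV = \<gamma> j + sum \<gamma> (UNIV - {j})" for \<gamma> :: "'n \<Rightarrow> nat"
    by (rule sum.remove) auto
  have "sum \<beta> (UNIV - {j}) = sum \<alpha> (UNIV - {j})"
    by (rule sum.cong) (auto simp: \<beta>_def)
  then have "sum \<beta> UNIV = k" using s[of \<alpha>] s[of \<beta>] Suc.prems j by (simp add: \<beta>_def)
  from hpoly.coord[OF Suc.IH[OF this], of j]
  have *: "hpoly (Suc k) (\<lambda>z. z $ j * (\<Prod>i\<in>UNIV. (z $ i) ^ \<beta> i))" .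
  have "(\<Prod>i\<in>UNIV. (z $ i) ^ \<alpha> i) = z $ j * (\<Prod>i\<in>UNIV. (z $ i) ^ \<beta> i)" for z :: "real^'n"
  proof -
    have r: "(\<Prod>i\<in>UNIV. (z $ i) ^ \<gamma> i) = (z $ j) ^ \<gamma> j * (\<Prod>i\<in>UNIV-{j}. (z $ i) ^ \<gamma> i)" for \<gamma>
      by (rule prod.remove) auto
    have "(\<Prod>i\<in>UNIV-{j}. (z $ i) ^ \<alpha> i) = (\<Prod>i\<in>UNIV-{j}. (z $ i) ^ \<beta> i)"
      by (rule prod.cong) (auto simp: \<beta>_def)
    then show ?thesis unfolding r[of \<alpha>] r[of \<beta>] using j by (simp add: \<beta>_def power_eq_if)
  qed
  with * show ?case by simp
qed

text \<open>Multiplication by \<open>z $ j\<close> shifts every multi-index by one in position j.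
  The new coefficients \<open>c'\<close> vanish where the exponent of \<open>z $ j\<close> is 0, so
  the shifted index set can be enlarged to all multi-indices of degree \<open>Suc k\<close>.\<close>

lemma homogeneous_poly_coord:
  assumes "homogeneous_poly k f"
  shows "homogeneous_poly (Suc k) (\<lambda>z :: real^'n::finite. z $ j * f z)"
proof -
  obtain c where c: "\<And>z. f z = (\<Sum>\<alpha>\<in>{\<alpha>. sum \<alpha> UNIV = k}. c \<alpha> * (\<Prod>i\<in>UNIV. (z $ i) ^ \<alpha> i))"
    using assms unfolding homogeneous_poly_def by auto
  define up where "up = (\<lambda>\<alpha> :: 'n \<Rightarrow> nat. \<alpha>(j := Suc (\<alpha> j)))"
  define dn where "dn = (\<lambda>\<alpha> :: 'n \<Rightarrow> nat. \<alpha>(j := \<alpha> j - 1))"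
  define c' where "c' = (\<lambda>\<alpha>. if \<alpha> j = 0 then 0 else c (dn \<alpha>))"
  have s: "sum \<gamma> UNIV = \<gamma> j + sum \<gamma> (UNIV - {j})" for \<gamma> :: "'n \<Rightarrow> nat"
    by (rule sum.remove) auto
  have r: "sum (\<gamma>(j := m)) (UNIV - {j}) = sum \<gamma> (UNIV - {j})" for \<gamma> :: "'n \<Rightarrow> nat" and m
    by (rule sum.cong) auto
  have su: "sum (up \<alpha>) UNIV = Suc (sum \<alpha> UNIV)" for \<alpha>
    using s[of \<alpha>] s[of "up \<alpha>"] by (simp add: up_def r)
  have sd: "\<alpha> j > 0 \<Longrightarrow> sum (dn \<alpha>) UNIV = sum \<alpha> UNIV - 1" for \<alpha>
    using s[of \<alpha>] s[of "dn \<alpha>"] by (simp add: dn_def r)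
  have ud: "dn (up \<alpha>) = \<alpha>" and j0: "up \<alpha> j \<noteq> 0" for \<alpha>
    by (auto simp: dn_def up_def)
  have du: "\<alpha> j \<noteq> 0 \<Longrightarrow> up (dn \<alpha>) = \<alpha>" for \<alpha> by (auto simp: dn_def up_def)
  have "z $ j * f z = (\<Sum>\<alpha>\<in>{\<alpha>. sum \<alpha> UNIV = Suc k}. c' \<alpha> * (\<Prod>i\<in>UNIV. (z $ i) ^ \<alpha> i))" for z
  proof -
    have pu: "(\<Prod>i\<in>UNIV. (z $ i) ^ up \<alpha> i) = z $ j * (\<Prod>i\<in>UNIV. (z $ i) ^ \<alpha> i)" for \<alpha>
    proof -
      have r: "(\<Prod>i\<in>UNIV. (z $ i) ^ \<gamma> i) = (z $ j) ^ \<gamma> j * (\<Prod>i\<in>UNIV-{j}. (z $ i) ^ \<gamma> i)" for \<gamma>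
        by (rule prod.remove) auto
      have "(\<Prod>i\<in>UNIV-{j}. (z $ i) ^ up \<alpha> i) = (\<Prod>i\<in>UNIV-{j}. (z $ i) ^ \<alpha> i)"
        by (rule prod.cong) (auto simp: up_def)
      then show ?thesis unfolding r[of \<alpha>] r[of "up \<alpha>"] by (simp add: up_def)
    qed
    have "z $ j * f z = (\<Sum>\<alpha>\<in>{\<alpha>. sum \<alpha> UNIV = k}. c' (up \<alpha>) * (\<Prod>i\<in>UNIV. (z $ i) ^ up \<alpha> i))"
      by (simp add: c sum_distrib_left pu) (simp add: c'_def dn_def up_def mult.left_commute)
    also have "\<dots> = (\<Sum>\<alpha>\<in>{\<alpha>. sum \<alpha> UNIV = Suc k \<and> \<alpha> j \<noteq> 0}. c' \<alpha> * (\<Prod>i\<in>UNIV. (z $ i) ^ \<alpha> i))"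
      by (rule sum.reindex_bij_witness[where i = dn and j = up])
        (auto simp: ud du su sd intro: gr0I dest: j0[THEN notE])
    also have "\<dots> = (\<Sum>\<alpha>\<in>{\<alpha>. sum \<alpha> UNIV = Suc k}. c' \<alpha> * (\<Prod>i\<in>UNIV. (z $ i) ^ \<alpha> i))"
      by (rule sum.mono_neutral_left) (auto simp: finite_multiindices c'_def)
    finally show ?thesis .
  qed
  then show ?thesis unfolding homogeneous_poly_def by blast
qed

text \<open>Justifies the inductive predicate: from here on, facts about polynomials are proved by
  induction over \<open>hpoly\<close> instead of by computing with multi-indices.\<close>

lemma homogeneous_poly_iff_hpoly: "homogeneous_poly k f \<longleftrightarrow> hpoly k f"
proof
  assume "homogeneous_poly k f"
  then obtain c where "f = (\<lambda>z. \<Sum>\<alpha>\<in>{\<alpha>. sum \<alpha> UNIV = k}. c \<alpha> * (\<Prod>i\<in>UNIV. (z $ i) ^ \<alpha> i))"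
    unfolding homogeneous_poly_def by auto
  then show "hpoly k f"
    by (auto intro!: hpoly_sum hpoly_cmult hpoly_monomial simp: finite_multiindices)
next
  assume "hpoly k f"
  then show "homogeneous_poly k f"
  proof (induction rule: hpoly.induct)
    case (const a)
    have "{\<alpha> :: 'a \<Rightarrow> nat. sum \<alpha> UNIV = 0} = {\<lambda>_. 0}" by auto
    then show ?case unfolding homogeneous_poly_def by (intro exI[of _ "\<lambda>_. a"]) simp
  next
    case (zero k)
    show ?case unfolding homogeneous_poly_def by (intro exI[of _ "\<lambda>_. 0"]) simp
  next
    case (add k f g)
    then obtain c c' where
      "\<And>x. f x = (\<Sum>\<alpha>\<in>{\<alpha>. sum \<alpha> UNIV = k}. c \<alpha> * (\<Prod>i\<in>UNIV. (x $ i) ^ (\<alpha> i)))"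
      "\<And>x. g x = (\<Sum>\<alpha>\<in>{\<alpha>. sum \<alpha> UNIV = k}. c' \<alpha> * (\<Prod>i\<in>UNIV. (x $ i) ^ (\<alpha> i)))"
      unfolding homogeneous_poly_def by auto
    then show ?case unfolding homogeneous_poly_def
      by (intro exI[of _ "\<lambda>\<alpha>. c \<alpha> + c' \<alpha>"]) (simp add: distrib_right sum.distrib)
  qed (rule homogeneous_poly_coord)
qed

lemma hpoly_continuous: "hpoly k f \<Longrightarrow> continuous_on A f"
  by (induction rule: hpoly.induct) (auto intro!: continuous_intros)

lemma hpoly_scaleR: "hpoly k f \<Longrightarrow> f (r *\<^sub>R z) = r ^ k * f z"
  by (induction rule: hpoly.induct) (auto simp: distrib_left)

section \<open>Partial derivatives of homogeneous polynomials\<close>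

lemma partial_derivI:
  "((\<lambda>t. f (z + t *\<^sub>R axis i 1)) has_real_derivative D) (at 0) \<Longrightarrow> partial_deriv i f z = D"
  by (simp add: partial_deriv_def DERIV_imp_deriv)

lemma DERIV_coord:
  "((\<lambda>t. (z + t *\<^sub>R axis i 1) $ l) has_real_derivative (if i = l then 1 else 0)) (at s)"
  by (auto simp: axis_def intro!: derivative_eq_intros)

text \<open>\<open>partial_deriv\<close> rests on \<open>deriv\<close>, which says something only
  where a derivative exists. For homogeneous polynomials it does, and the rules for sums and
  products below depend on that.\<close>

lemma hpoly_DERIV0:
  "hpoly k f \<Longrightarrow> ((\<lambda>t. f (z + t *\<^sub>R axis i 1)) has_real_derivative partial_deriv i f z) (at 0)"
proof (induction rule: hpoly.induct)
  case (coord k f l)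
  have "((\<lambda>t. (z + t *\<^sub>R axis i 1) $ l * f (z + t *\<^sub>R axis i 1)) has_real_derivative
      (if i = l then 1 else 0) * f z + z $ l * partial_deriv i f z) (at 0)"
    using DERIV_mult[OF DERIV_coord[of z i l 0] coord.IH] by (simp add: mult.commute)
  with partial_derivI[OF this] show ?case by simp
next
  case (add k f g)
  from DERIV_add[OF add.IH] have *: "((\<lambda>t. f (z + t *\<^sub>R axis i 1) + g (z + t *\<^sub>R axis i 1))
    has_real_derivative (partial_deriv i f z + partial_deriv i g z)) (at 0)" .
  with partial_derivI[OF *] show ?case by simp
qed (auto simp: partial_deriv_def)

lemma hpoly_DERIV:
  assumes "hpoly k f"
  shows "((\<lambda>t. f (z + t *\<^sub>R axis i 1)) has_real_derivative
    partial_deriv i f (z + s *\<^sub>R axis i 1)) (at s)"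
proof -
  have "((\<lambda>t. f ((z + s *\<^sub>R axis i 1) + t *\<^sub>R axis i 1)) has_real_derivative
      partial_deriv i f (z + s *\<^sub>R axis i 1)) (at (s - s))"
    using hpoly_DERIV0[OF assms] by simp
  then have "((\<lambda>t. f ((z + s *\<^sub>R axis i 1) + (t - s) *\<^sub>R axis i 1)) has_real_derivative
      partial_deriv i f (z + s *\<^sub>R axis i 1)) (at s)"
    using DERIV_at_within_shift[of "\<lambda>t. f ((z + s *\<^sub>R axis i 1) + t *\<^sub>R axis i 1)" _ "-s" s UNIV]
    by simp
  then show ?thesis by (simp add: scaleR_left_diff_distrib)
qed

lemma partial_deriv_const: "partial_deriv i (\<lambda>_. a) = (\<lambda>_. 0)"
  by (simp add: partial_deriv_def fun_eq_iff)

lemma partial_deriv_add: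
  "hpoly k f \<Longrightarrow> hpoly l g \<Longrightarrow>
   partial_deriv i (\<lambda>z. f z + g z) = (\<lambda>z. partial_deriv i f z + partial_deriv i g z)"
  by (intro ext partial_derivI DERIV_add hpoly_DERIV0)

lemma partial_deriv_mult:
  assumes "hpoly k f" "hpoly l g"
  shows "partial_deriv i (\<lambda>z. f z * g z) = (\<lambda>z. partial_deriv i f z * g z + f z * partial_deriv i g z)"
proof
  fix z
  show "partial_deriv i (\<lambda>z. f z * g z) z = partial_deriv i f z * g z + f z * partial_deriv i g z"
    using DERIV_mult[OF assms[THEN hpoly_DERIV0], of z i z i] by (intro partial_derivI) (simp add: mult.commute)
qed

lemma partial_deriv_cmult:
  "hpoly k f \<Longrightarrow> partial_deriv i (\<lambda>z. a * f z) = (\<lambda>z. a * partial_deriv i f z)"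
  using partial_deriv_mult[OF hpoly.const, of k f i a] by (simp add: partial_deriv_const)

lemma partial_deriv_coord:
  "hpoly k f \<Longrightarrow> partial_deriv i (\<lambda>z. z $ l * f z) =
    (\<lambda>z. (if i = l then f z else 0) + z $ l * partial_deriv i f z)"
proof
  fix z assume "hpoly k f"
  then show "partial_deriv i (\<lambda>z. z $ l * f z) z = (if i = l then f z else 0) + z $ l * partial_deriv i f z"
    using DERIV_mult[OF DERIV_coord[of z i l 0] hpoly_DERIV0[of k f z i]]
    by (intro partial_derivI) (cases "i = l", simp_all add: mult.commute)
qed

lemma partial_deriv_sum:
  "finite I \<Longrightarrow> (\<And>j. j \<in> I \<Longrightarrow> hpoly k (f j)) \<Longrightarrow>
   partial_deriv i (\<lambda>z. \<Sum>j\<in>I. f j z) = (\<lambda>z. \<Sum>j\<in>I. partial_deriv i (f j) z)"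
  by (intro ext partial_derivI DERIV_sum hpoly_DERIV0) auto

lemma hpoly_0_partial_deriv: "hpoly k f \<Longrightarrow> k = 0 \<Longrightarrow> partial_deriv i f = (\<lambda>_. 0)"
  by (induction rule: hpoly.induct) (auto simp: partial_deriv_const partial_deriv_add)

text \<open>Truncated subtraction is harmless here: in degree 0 the derivative is the zero function,
  which is homogeneous of every degree.\<close>

lemma hpoly_partial_deriv: "hpoly k f \<Longrightarrow> hpoly (k - 1) (partial_deriv i f)"
proof (induction rule: hpoly.induct)
  case (coord k f l)
  have "hpoly k (\<lambda>z. z $ l * partial_deriv i f z)"
  proof (cases k)
    case 0
    with coord.hyps show ?thesis by (simp add: hpoly_0_partial_deriv hpoly.const)
  next
    case (Suc m)
    with hpoly.coord[OF coord.IH] show ?thesis by simp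
  qed
  moreover have "hpoly k (\<lambda>z. if i = l then f z else 0)"
    using coord.hyps by (cases "i = l") (auto intro: hpoly.zero)
  ultimately show ?case
    using hpoly.add[of k "\<lambda>z. if i = l then f z else 0" "\<lambda>z. z $ l * partial_deriv i f z"]
    by (simp add: partial_deriv_coord[OF coord.hyps])
qed (auto simp: partial_deriv_const partial_deriv_add intro: hpoly.intros)

text \<open>By structural induction, without any theorem on mixed derivatives: in the case of a
  factor \<open>z $ l\<close>, the expansion \<open>a\<close> is symmetric in i and j up to the
  order of two summands.\<close>

lemma partial_deriv_commute:
  "hpoly k f \<Longrightarrow> partial_deriv i (partial_deriv j f) = partial_deriv j (partial_deriv i f)"
proof (induction rule: hpoly.induct)
  case (coord k f l)
  have h: "hpoly k f" by fact
  have a: "partial_deriv i (partial_deriv j (\<lambda>z. z $ l * f z)) =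
     (\<lambda>z. (if j = l then partial_deriv i f z else 0) + ((if i = l then partial_deriv j f z else 0)
         + z $ l * partial_deriv i (partial_deriv j f) z))" for i j
  proof -
    have h1: "hpoly k (\<lambda>z. if j = l then f z else 0)" using h by (cases "j = l") (auto intro: hpoly.zero)
    have h2: "hpoly (Suc (k - 1)) (\<lambda>z. z $ l * partial_deriv j f z)"
      using h by (intro hpoly.coord hpoly_partial_deriv)
    have "partial_deriv i (\<lambda>z. if j = l then f z else 0) = (\<lambda>z. if j = l then partial_deriv i f z else 0)"
      by (auto simp: partial_deriv_const)
    then show ?thesis
      by (simp add: partial_deriv_coord[OF h] partial_deriv_add[OF h1 h2]
          partial_deriv_coord[OF hpoly_partial_deriv[OF h]])
  qed
  show ?case unfolding a[of i j] a[of j i] coord.IH by (auto simp: fun_eq_iff)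
next
  case (add k f g)
  then show ?case
    by (simp add: partial_deriv_add partial_deriv_add[OF hpoly_partial_deriv hpoly_partial_deriv])
qed (simp_all add: partial_deriv_const)

text \<open>Euler's identity. It turns the radial derivative back into the function and is the
  source of the factor k in the integral identities.\<close>

lemma hpoly_euler: "hpoly k f \<Longrightarrow> (\<Sum>i\<in>UNIV. z $ i * partial_deriv i f z) = real k * f z"
proof (induction rule: hpoly.induct)
  case (coord k f l)
  have "(\<Sum>i\<in>UNIV. z $ i * partial_deriv i (\<lambda>z. z $ l * f z) z) =
     (\<Sum>i\<in>UNIV. (if i = l then z $ l * f z else 0) + z $ l * (z $ i * partial_deriv i f z))"
    by (rule sum.cong) (auto simp: partial_deriv_coord[OF coord.hyps] distrib_left mult.left_commute)
  also have "\<dots> = z $ l * f z + z $ l * (real k * f z)"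
    by (simp add: sum.distrib sum_distrib_left[symmetric] coord.IH)
  finally show ?case by (simp add: algebra_simps)
next
  case (add k f g)
  then show ?case by (simp add: partial_deriv_add distrib_left sum.distrib)
qed (simp_all add: partial_deriv_const)

section \<open>Spherical harmonics and their derivatives\<close>

lemma sph_harm_iff:
  "f \<in> sph_harm k \<longleftrightarrow> hpoly k f \<and> (\<forall>z. (\<Sum>i\<in>UNIV. partial_deriv i (partial_deriv i f) z) = 0)"
  by (simp add: sph_harm_def homogeneous_poly_iff_hpoly laplacian_def)

text \<open>Partial derivatives commute with the Laplacian. This keeps the Funk-Hecke induction
  inside spherical harmonics when a derivative falls on Y.\<close>

lemma sph_harm_partial_deriv:
  assumes "f \<in> sph_harm k"
  shows "partial_deriv j f \<in> sph_harm (k - 1)"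
proof -
  have h: "hpoly k f" using assms by (simp add: sph_harm_iff)
  have "partial_deriv i (partial_deriv i (partial_deriv j f)) =
      partial_deriv j (partial_deriv i (partial_deriv i f))" for i
    by (metis h hpoly_partial_deriv partial_deriv_commute)
  moreover have "(\<Sum>i\<in>UNIV. partial_deriv j (partial_deriv i (partial_deriv i f)) z) = 0" for z
  proof -
    have "(\<lambda>z. \<Sum>i\<in>UNIV. partial_deriv j (partial_deriv i (partial_deriv i f)) z) =
        partial_deriv j (\<lambda>z. \<Sum>i\<in>UNIV. partial_deriv i (partial_deriv i f) z)"
      by (rule partial_deriv_sum[symmetric, where k = "k - 1 - 1"]) (simp, intro hpoly_partial_deriv h)
    also have "\<dots> = (\<lambda>_. 0)" using assms by (simp add: sph_harm_iff partial_deriv_const)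
    finally show ?thesis by meson
  qed
  ultimately show ?thesis using hpoly_partial_deriv[OF h, of j] by (simp add: sph_harm_iff)
qed

lemma partial_deriv_inner: "partial_deriv i (\<lambda>z. x \<bullet> z) = (\<lambda>_. x $ i)"
  by (intro ext partial_derivI)
    (auto simp: inner_add_right inner_axis intro!: derivative_eq_intros)

lemma partial_deriv_norm_sq: "partial_deriv i (\<lambda>z. (norm z)\<^sup>2) = (\<lambda>z. 2 * z $ i)"
proof (intro ext partial_derivI)
  fix z :: "real^'a"
  have *: "(norm (z + t *\<^sub>R axis i 1))\<^sup>2 = (norm z)\<^sup>2 + 2 * t * z $ i + t\<^sup>2" for t
    unfolding power2_norm_eq_inner
    by (simp add: inner_add_left inner_add_right inner_axis inner_axis' axis_nth power2_eq_square distrib_left)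
  show "((\<lambda>t. (norm (z + t *\<^sub>R axis i 1))\<^sup>2) has_real_derivative 2 * z $ i) (at 0)"
    unfolding * by (auto intro!: derivative_eq_intros)
qed

subsection \<open>Integration over the sphere\<close>

lemma sets_ball[measurable]: "ball x r \<in> sets borel"
  by (intro borel_open open_ball)

lemma sphere_measure_density:
  "sphere_measure = distr (density lborel (\<lambda>x :: real^'n::finite. ennreal (real CARD('n) * indicator (ball 0 1 - {0}) x)))
           borel (\<lambda>x. x /\<^sub>R norm x)"
  unfolding sphere_measure_def by (simp add: ennreal_mult' ennreal_indicator)

lemma sets_sphere_measure[simp, measurable_cong]: "sets sphere_measure = sets borel"
  by (simp add: sphere_measure_def)

lemma space_sphere_measure[simp]: "space sphere_measure = UNIV"
  by (simp add: sphere_measure_def)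

lemma AE_sphere_measure: "AE z in sphere_measure. z \<in> sphere 0 1"
  unfolding sphere_measure_density
  by (subst AE_distr_iff) (auto simp: AE_density indicator_def)

text \<open>Unfolds the pushforward; the puncture at the origin is a Lebesgue null set and is filled
  in again.\<close>

lemma sphere_integral_eq_ball_integral:
  fixes f :: "real^'n::finite \<Rightarrow> real"
  assumes [measurable]: "f \<in> borel_measurable borel"
  shows "(LINT z|sphere_measure. f z) =
    real CARD('n) * (LINT z|lborel. indicator (ball 0 1) z * f (z /\<^sub>R norm z))"
proof -
  have [measurable]: "(\<lambda>z::real^'n. real CARD('n) * indicator (ball 0 1 - {0}) z) \<in> borel_measurable borel"
    by measurable
  have "(LINT z|sphere_measure. f z) =
     (LINT z|lborel. (real CARD('n) * indicator (ball 0 1 - {0}) z) *\<^sub>R f (z /\<^sub>R norm z))"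
    unfolding sphere_measure_density by (subst integral_distr, measurable) (subst integral_density, auto intro!: borel_open open_delete)
  also have "\<dots> = (LINT z|lborel. real CARD('n) * (indicator (ball 0 1) z * f (z /\<^sub>R norm z)))"
  proof (rule integral_cong_AE)
    show "AE z in lborel. (real CARD('n) * indicator (ball 0 1 - {0}) z) *\<^sub>R f (z /\<^sub>R norm z) =
        real CARD('n) * (indicator (ball 0 1) z * f (z /\<^sub>R norm z))"
      using AE_lborel_singleton[of "0::real^'n"] by eventually_elim (auto simp: indicator_def)
  qed simp_all
  finally show ?thesis by simp
qed

lemma finite_measure_sphere_measure: "finite_measure (sphere_measure :: (real^'n::finite) measure)"
proof
  have "emeasure lborel (ball 0 1 - {0} :: (real^'n) set) < \<infinity>"
    by (rule emeasure_bounded_finite) (meson Diff_subset bounded_ball bounded_subset)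
  then show "emeasure (sphere_measure :: (real^'n) measure) (space sphere_measure) \<noteq> \<infinity>"
    unfolding sphere_measure_def
    by (simp add: emeasure_distr, subst emeasure_density, measurable)
      (auto simp: nn_integral_cmult ennreal_mult_eq_top_iff less_top)
qed

lemma integrable_sphere_measure:
  fixes f :: "real^'n::finite \<Rightarrow> real"
  assumes "continuous_on UNIV f"
  shows "integrable sphere_measure f"
proof -
  have "compact (f ` sphere 0 1)"
    by (rule compact_continuous_image[OF continuous_on_subset[OF assms]]) auto
  then obtain M where M: "\<And>z. z \<in> sphere 0 1 \<Longrightarrow> norm (f z) \<le> M"
    using compact_imp_bounded bounded_iff by (metis imageI)
  have [measurable]: "f \<in> borel_measurable borel" using assms by (rule borel_measurable_continuous_onI)
  have "AE z in sphere_measure. norm (f z) \<le> M"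
    using AE_sphere_measure by eventually_elim (rule M)
  then show ?thesis
    by (rule finite_measure.integrable_const_bound[OF finite_measure_sphere_measure]) measurable
qed

lemma sphere_measure_pos: "measure (sphere_measure :: (real^'n::finite) measure) UNIV > 0"
proof -
  have "measure (sphere_measure :: (real^'n) measure) UNIV = (\<integral>z. 1 \<partial>(sphere_measure :: (real^'n) measure))"
    by simp
  also have "\<dots> = real CARD('n) * measure lborel (ball 0 1 :: (real^'n) set)"
    by (subst sphere_integral_eq_ball_integral) auto
  finally show ?thesis using content_ball_pos[of 1 "0::real^'n"] by simp
qed

section \<open>From ball integrals to sphere integrals\<close>

lemma integral_homogeneous_ball:
  fixes g :: "real^'n::finite \<Rightarrow> real"
  assumes [measurable]: "g \<in> borel_measurable borel"
    and hom: "\<And>r z. r > 0 \<Longrightarrow> g (r *\<^sub>R z) = g z" and r: "r > 0"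
  shows "(LINT z|lborel. indicator (ball 0 r) z * g z) = r ^ CARD('n) * (LINT z|lborel. indicator (ball 0 1) z * g z)"
proof -
  have "(LINT z|lborel. indicator (ball 0 r) z * g z) =
      (LINT z|density (distr lborel borel (\<lambda>x. 0 + r *\<^sub>R x)) (\<lambda>_. ennreal (\<bar>r\<bar> ^ DIM(real^'n))). indicator (ball 0 r) z * g z)"
    using lborel_affine[of r "0::real^'n"] r by simp
  also have "\<dots> = (LINT z|distr lborel borel (\<lambda>x. 0 + r *\<^sub>R x). (\<bar>r\<bar> ^ DIM(real^'n)) *\<^sub>R (indicator (ball 0 r) z * g z))"
    using r by (intro integral_density) auto
  also have "\<dots> = (LINT z|lborel. (\<bar>r\<bar> ^ DIM(real^'n)) *\<^sub>R (indicator (ball 0 r) (0 + r *\<^sub>R z) * g (0 + r *\<^sub>R z)))"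
    by (intro integral_distr) auto
  also have "\<dots> = (LINT z|lborel. r ^ CARD('n) * (indicator (ball 0 1) z * g z))"
    using r by (intro Bochner_Integration.integral_cong) (auto simp: hom indicator_def)
  finally show ?thesis by simp
qed

lemma integral_power_Ioc:
  assumes "a \<le> (b::real)"
  shows "(LINT x|lborel. indicator {a<..b} x * (real (Suc p) * x ^ p)) = b ^ Suc p - a ^ Suc p"
proof -
  have "(LINT x|lborel. indicator {a<..b} x * (real (Suc p) * x ^ p)) =
      (LINT x|lborel. real (Suc p) * (x ^ p * indicator {a..b} x))"
    by (rule integral_cong_AE, measurable)
      (use AE_lborel_singleton[of a] in \<open>eventually_elim; auto simp: indicator_def\<close>)
  also have "\<dots> = b ^ Suc p - a ^ Suc p" using integral_power[OF assms, of p] by simp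
  finally show ?thesis .
qed

text \<open>Takes the place of polar coordinates. Write 1 - |z|^q as the integral of q r^(q-1) over
  |z| < r <= 1 and exchange the integrals: the inner one runs over the ball of radius r and equals
  r^d times that over the unit ball. The difference of the two ball integrals is thus q / (q + d)
  times the integral of g.\<close>

lemma integral_homogeneous_norm_power:
  fixes g :: "real^'n::finite \<Rightarrow> real"
  assumes [measurable]: "g \<in> borel_measurable borel"
    and bound: "\<And>z. \<bar>g z\<bar> \<le> M"
    and hom: "\<And>r z. r > 0 \<Longrightarrow> g (r *\<^sub>R z) = g z"
  shows "(real q + real CARD('n)) * (LINT z|lborel. indicator (ball 0 1) z * (g z * norm z ^ q)) =
    real CARD('n) * (LINT z|lborel. indicator (ball 0 1) z * g z)"
proof (cases q)
  case 0
  then show ?thesis by simp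
next
  case (Suc p)
  let ?J = "LINT z|lborel. indicator (ball 0 1) z * g z"
  let ?d = "CARD('n)"
  define u where "u = (\<lambda>(z::real^'n) r. (indicator (ball 0 1) z * g z) * (indicator {norm z<..1} r * (real (Suc p) * r ^ p)))"
  have ind: "indicator {norm z<..1} r = (if norm z < r \<and> r \<le> 1 then 1 else 0 :: real)" for z :: "real^'n" and r
    by (auto simp: indicator_def)
  have M0: "M \<ge> 0" using bound[of 0] by linarith
  have int: "integrable (lborel \<Otimes>\<^sub>M lborel) (case_prod u)"
  proof (rule Bochner_Integration.integrable_bound)
    have "emeasure lborel (ball 0 1 \<times> {0..1} :: ((real^'n) \<times> real) set) < \<infinity>"
      by (rule emeasure_bounded_finite) (auto intro: bounded_Times)
    then show "integrable (lborel \<Otimes>\<^sub>M lborel) (\<lambda>w. (M * real (Suc p)) * indicator (ball 0 1 \<times> {0..1} :: ((real^'n) \<times> real) set) w)"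
      unfolding lborel_prod
      by (intro integrable_mult_right integrable_real_indicator) (auto intro!: borel_open borel_closed simp: borel_Times)
    show "case_prod u \<in> borel_measurable (lborel \<Otimes>\<^sub>M lborel)"
      unfolding u_def ind split_beta' by measurable
    show "AE w in lborel \<Otimes>\<^sub>M lborel. norm (case_prod u w) \<le> norm ((M * real (Suc p)) * indicator (ball 0 1 \<times> {0..1}) w)"
    proof (rule AE_I2, clarify)
      fix z :: "real^'n" and r :: real
      show "norm (u z r) \<le> norm ((M * real (Suc p)) * indicator (ball 0 1 \<times> {0..1}) (z, r))"
      proof (cases "norm z < r \<and> r \<le> 1")
        case True
        then have r: "0 \<le> r" "r \<le> 1" using norm_ge_zero[of z] by linarith+
        have "\<bar>g z\<bar> * (real (Suc p) * r ^ p) \<le> M * (real (Suc p) * 1)"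
          using r M0 bound by (intro mult_mono power_le_one) auto
        then show ?thesis using True r M0 by (simp add: u_def ind abs_mult)
      qed (auto simp: u_def ind)
    qed
  qed
  have inner: "(LINT r|lborel. u z r) = indicator (ball 0 1) z * g z - indicator (ball 0 1) z * (g z * norm z ^ q)" for z
  proof (cases "norm z < 1")
    case True
    then have "(LINT r|lborel. u z r) = g z * (1 - norm z ^ Suc p)"
      using integral_power_Ioc[of "norm z" 1 p] by (simp add: u_def)
    then show ?thesis using True Suc by (simp add: algebra_simps)
  qed (simp add: u_def)
  have L: "(LINT z|lborel. LINT r|lborel. u z r) = ?J - (LINT z|lborel. indicator (ball 0 1) z * (g z * norm z ^ q))"
  proof -
    have B: "emeasure lborel (ball 0 1 :: (real^'n) set) < \<infinity>"
      by (rule emeasure_bounded_finite) auto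
    have i: "integrable lborel (\<lambda>z. indicator (ball 0 1) z * h z)"
      if [measurable]: "h \<in> borel_measurable borel" and "\<And>z. norm z < 1 \<Longrightarrow> \<bar>h z\<bar> \<le> M" for h :: "real^'n \<Rightarrow> real"
      by (rule Bochner_Integration.integrable_bound[of _ "\<lambda>z. M * indicator (ball 0 1) z"])
        (use B that M0 in \<open>auto simp: abs_mult split: split_indicator\<close>)
    have "\<bar>g z * norm z ^ q\<bar> \<le> M" if "norm z < 1" for z
    proof -
      have "\<bar>g z\<bar> * norm z ^ q \<le> M * 1" using that bound M0 by (intro mult_mono power_le_one) auto
      then show ?thesis by (simp add: abs_mult)
    qed
    then have "integrable lborel (\<lambda>z. indicator (ball 0 1) z * (g z * norm z ^ q))" by (intro i) auto
    moreover have "integrable lborel (\<lambda>z. indicator (ball 0 1) z * g z)" by (intro i) (auto simp: bound)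
    ultimately show ?thesis by (simp add: inner)
  qed
  have "(LINT z|lborel. u z r) = indicator {0<..1} r * ((real (Suc p) * r ^ p) * r ^ ?d * ?J)" for r
  proof (cases "0 < r \<and> r \<le> 1")
    case True
    have "(LINT z|lborel. u z r) = (LINT z|lborel. (real (Suc p) * r ^ p) * (indicator (ball 0 r) z * g z))"
      using True by (intro Bochner_Integration.integral_cong) (auto simp: u_def ind indicator_def)
    also have "\<dots> = (real (Suc p) * r ^ p) * (r ^ ?d * ?J)"
      using True integral_homogeneous_ball[of g r] hom by simp
    finally show ?thesis using True by simp
  next
    case False
    then have "u z r = 0" for z using norm_ge_zero[of z] by (auto simp: u_def ind simp del: norm_ge_zero)
    then show ?thesis using False by simp
  qed
  then have "(LINT r|lborel. LINT z|lborel. u z r) =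
     (LINT r|lborel. (real (Suc p) * ?J / real (Suc (p + ?d))) * (indicator {0<..1} r * (real (Suc (p + ?d)) * r ^ (p + ?d))))"
    by (intro Bochner_Integration.integral_cong) (auto simp: power_add)
  also have "\<dots> = real (Suc p) * ?J / real (Suc (p + ?d))"
    unfolding Bochner_Integration.integral_mult_right_zero
    using integral_power_Ioc[of 0 1 "p + ?d"] by (simp del: of_nat_Suc)
  finally have R: "(LINT r|lborel. LINT z|lborel. u z r) = real (Suc p) * ?J / real (Suc (p + ?d))" .
  have "?J - (LINT z|lborel. indicator (ball 0 1) z * (g z * norm z ^ q)) = real q * ?J / (real q + real ?d)"
    using lborel_pair.Fubini_integral[OF int] unfolding L R using Suc by (simp add: add.assoc)
  then show ?thesis using Suc by (simp add: field_simps)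
qed

text \<open>A polynomial of degree m is |z|^m times its degree-0 extension \<open>g\<close> from the
  sphere, so the radial integration contributes the factor 1 / (m + p + d).\<close>

lemma hpoly_ball_integral:
  fixes h :: "real^'n::finite \<Rightarrow> real"
  assumes h: "hpoly m h"
  shows "(LINT z|lborel. indicator (ball 0 1) z * (h z * norm z ^ p)) =
    (LINT z|sphere_measure. h z) / (real m + real p + real CARD('n))"
proof -
  define g where "g = (\<lambda>z. h (z /\<^sub>R norm z))"
  have [measurable]: "h \<in> borel_measurable borel"
    by (intro borel_measurable_continuous_onI hpoly_continuous[OF h])
  \<comment> \<open>Division by zero gives \<open>g 0 = h 0\<close>, so h has to be bounded at the
    origin as well as on the sphere.\<close>
  have "compact (h ` cball 0 1)"
    by (rule compact_continuous_image[OF hpoly_continuous[OF h]]) auto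
  then obtain M where M: "\<And>z. z \<in> cball 0 1 \<Longrightarrow> norm (h z) \<le> M"
    using compact_imp_bounded bounded_iff by (metis imageI)
  have gh: "h z = g z * norm z ^ m" for z
    using hpoly_scaleR[OF h, of "norm z" "z /\<^sub>R norm z"] by (cases "z = 0") (auto simp: g_def)
  have "\<bar>g z\<bar> \<le> M" for z using M[of "z /\<^sub>R norm z"] by (cases "z = 0") (auto simp: g_def)
  moreover have "r > 0 \<Longrightarrow> g (r *\<^sub>R z) = g z" for r z
    by (simp add: g_def field_simps)
  moreover have "g \<in> borel_measurable borel" unfolding g_def by measurable
  ultimately have "(real (m + p) + real CARD('n)) * (LINT z|lborel. indicator (ball 0 1) z * (g z * norm z ^ (m + p)))
     = real CARD('n) * (LINT z|lborel. indicator (ball 0 1) z * g z)"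
    by (intro integral_homogeneous_norm_power)
  also have "\<dots> = (LINT z|sphere_measure. h z)"
    by (subst sphere_integral_eq_ball_integral) (auto simp: g_def)
  finally show ?thesis unfolding gh by (simp add: power_add field_simps add_nonneg_eq_0_iff)
qed

text \<open>Translation invariance of Lebesgue measure makes the integral of a difference quotient vanish.\<close>

lemma integral_directional_deriv_eq_0:
  fixes F F' :: "real^'n::finite \<Rightarrow> real" and e :: "real^'n"
  assumes der: "\<And>z s. ((\<lambda>t. F (z + t *\<^sub>R e)) has_real_derivative F' (z + s *\<^sub>R e)) (at s)"
    and F: "continuous_on UNIV F" and F': "continuous_on UNIV F'"
    and supp: "\<And>z. norm z \<ge> 1 \<Longrightarrow> F z = 0" "\<And>z. norm z \<ge> 1 \<Longrightarrow> F' z = 0"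
    and e: "norm e = 1"
  shows "(LINT z|lborel. F' z) = 0"
proof -
  have [measurable]: "F \<in> borel_measurable borel" "F' \<in> borel_measurable borel"
    using F F' by (auto intro: borel_measurable_continuous_onI)
  have bd: "\<exists>M\<ge>0. \<forall>z. \<bar>f z\<bar> \<le> M" if "continuous_on UNIV f" "\<And>z. norm z \<ge> 1 \<Longrightarrow> f z = 0" for f :: "real^'n \<Rightarrow> real"
  proof -
    have "compact (f ` cball 0 1)"
      by (rule compact_continuous_image[OF continuous_on_subset[OF that(1)]]) auto
    then obtain M where M: "\<And>z. z \<in> cball 0 1 \<Longrightarrow> norm (f z) \<le> M"
      using compact_imp_bounded bounded_iff by (metis imageI)
    have "M \<ge> 0" using M[of 0] by (simp add: order_trans[OF abs_ge_zero])
    moreover have "\<bar>f z\<bar> \<le> M" for z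
      using M[of z] that(2)[of z] \<open>M \<ge> 0\<close> by (cases "norm z \<le> 1") auto
    ultimately show ?thesis by blast
  qed
  obtain M where M: "M \<ge> 0" "\<And>z. \<bar>F' z\<bar> \<le> M" using bd[OF F' supp(2)] by blast
  obtain M1 where M1: "M1 \<ge> 0" "\<And>z. \<bar>F z\<bar> \<le> M1" using bd[OF F supp(1)] by blast
  have B: "emeasure lborel (cball 0 2 :: (real^'n) set) < \<infinity>"
    by (rule emeasure_bounded_finite) auto
  have cb[measurable]: "cball 0 2 \<in> sets (borel :: (real^'n) measure)" by (intro borel_closed closed_cball)
  have intF: "integrable lborel F"
    by (rule Bochner_Integration.integrable_bound[of _ "\<lambda>z. M1 * indicator (cball 0 2) z"])
      (use B M1 supp(1) in \<open>auto split: split_indicator\<close>)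
  have shift: "integrable lborel (\<lambda>z. F (z + v))" "(LINT z|lborel. F (z + v)) = (LINT z|lborel. F z)" for v
  proof -
    have "integrable (distr lborel borel ((+) v)) F" using intF by (simp add: lborel_distr_plus)
    then show "integrable lborel (\<lambda>z. F (z + v))" by (subst (asm) integrable_distr_eq) (auto simp: add.commute)
    have "(LINT z|lborel. F z) = (LINT z|distr lborel borel ((+) v). F z)" by (simp add: lborel_distr_plus)
    also have "\<dots> = (LINT z|lborel. F (z + v))" by (subst integral_distr) (auto simp: add.commute)
    finally show "(LINT z|lborel. F (z + v)) = (LINT z|lborel. F z)" ..
  qed
  \<comment> \<open>Steps of length at most 1 keep the difference quotients of a function supported
    in the unit ball inside the ball of radius 2, where the mean value bound M is an integrable
    majorant.\<close>
  define h where "h = (\<lambda>n. 1 / real (Suc n))"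
  have h: "0 < h n" "h n \<le> 1" for n by (auto simp: h_def)
  define s where "s = (\<lambda>n z. (F (z + h n *\<^sub>R e) - F z) / h n)"
  have "(\<lambda>n. LINT z|lborel. s n z) \<longlonglongrightarrow> (LINT z|lborel. F' z)"
  proof (rule integral_dominated_convergence[where w = "\<lambda>z. M * indicator (cball 0 2) z"])
    show "integrable lborel (\<lambda>z. M * indicator (cball 0 2 :: (real^'n) set) z)" using B by auto
    show "AE z in lborel. (\<lambda>n. s n z) \<longlonglongrightarrow> F' z"
    proof (rule AE_I2)
      fix z
      have "((\<lambda>t. (F (z + t *\<^sub>R e) - F z) / t) \<longlongrightarrow> F' z) (at 0)"
        using der[of z 0] by (simp add: DERIV_def)
      moreover have "filterlim h (at 0) sequentially"
        unfolding filterlim_at using lim_1_over_n[where 'a = real, THEN LIMSEQ_Suc] h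
        by (auto simp: h_def)
      ultimately show "(\<lambda>n. s n z) \<longlonglongrightarrow> F' z"
        unfolding s_def by (rule filterlim_compose)
    qed
    show "AE z in lborel. norm (s n z) \<le> M * indicator (cball 0 2) z" for n
    proof (rule AE_I2)
      fix z
      have "norm (F (z + h n *\<^sub>R e) - F (z + 0 *\<^sub>R e)) \<le> M * norm (h n - 0)"
        by (rule field_differentiable_bound[of UNIV "\<lambda>t. F (z + t *\<^sub>R e)" "\<lambda>t. F' (z + t *\<^sub>R e)"])
          (use der M in auto)
      then have 1: "norm (s n z) \<le> M" using h[of n] by (simp add: s_def field_simps)
      have 2: "s n z = 0" if "norm z > 2"
      proof -
        have "norm z \<le> norm (z + h n *\<^sub>R e) + norm (h n *\<^sub>R e)" using norm_triangle_ineq4[of "z + h n *\<^sub>R e" "h n *\<^sub>R e"] by simp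
        then have "norm (z + h n *\<^sub>R e) \<ge> 1" using h[of n] e that by simp
        then show ?thesis using supp(1) that by (simp add: s_def)
      qed
      show "norm (s n z) \<le> M * indicator (cball 0 2) z" using 1 2 by (auto split: split_indicator)
    qed
  qed (auto simp: s_def)
  moreover have "(LINT z|lborel. s n z) = 0" for n
    using shift intF by (simp add: s_def)
  ultimately show ?thesis by (simp add: LIMSEQ_const_iff)
qed

section \<open>Integration by parts on the sphere\<close>

lemma DERIV_max0_sq: "((\<lambda>s::real. (max 0 s)\<^sup>2) has_real_derivative 2 * max 0 s) (at s)"
proof (cases s "0::real" rule: linorder_cases)
  case less
  have "((\<lambda>s::real. 0) has_real_derivative 2 * max 0 s) (at s)" using less by simp
  then show ?thesis
    by (rule DERIV_cong_ev[OF refl _ refl, THEN iffD1, rotated])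
      (use eventually_nhds_in_open[of "{..<0}" s] less in \<open>auto elim!: eventually_mono\<close>)
next
  case greater
  have "((\<lambda>s::real. s\<^sup>2) has_real_derivative 2 * max 0 s) (at s)"
    using greater by (auto intro!: derivative_eq_intros)
  then show ?thesis
    by (rule DERIV_cong_ev[OF refl _ refl, THEN iffD1, rotated])
      (use eventually_nhds_in_open[of "{0<..}" s] greater in \<open>auto elim!: eventually_mono\<close>)
next
  case equal
  have "((\<lambda>h::real. (max 0 h)\<^sup>2 / h) \<longlongrightarrow> 0) (at 0)"
  proof (rule Lim_null_comparison)
    show "\<forall>\<^sub>F h::real in at 0. norm ((max 0 h)\<^sup>2 / h) \<le> \<bar>h\<bar>"
      by (rule always_eventually) (auto simp: max_def power2_eq_square)
  qed (auto intro!: tendsto_eq_intros)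
  then show ?thesis using equal by (simp add: DERIV_def)
qed

text \<open>This is the divergence theorem for the ball in homogeneous form. The integral of the
  i-th derivative of f times a cutoff vanishes; expanding the cutoff gives ball integrals of
  polynomials times powers of the norm, all of which are multiples of the two sphere integrals in
  the statement.\<close>

lemma sphere_integral_by_parts:
  fixes f :: "real^'n::finite \<Rightarrow> real"
  assumes f: "hpoly m f"
  shows "(real m + real CARD('n) - 1) * (LINT z|sphere_measure. z $ i * f z) =
    (LINT z|sphere_measure. partial_deriv i f z)"
proof -
  \<comment> \<open>Squaring the positive part makes the cutoff continuously differentiable across
    the unit sphere, while inside the ball it stays a polynomial in the squared norm.\<close>
  define F where "F = (\<lambda>z::real^'n. f z * (max 0 (1 - (norm z)\<^sup>2))\<^sup>2)"
  define F' where "F' = (\<lambda>z::real^'n. partial_deriv i f z * (max 0 (1 - (norm z)\<^sup>2))\<^sup>2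
     - 4 * (z $ i * f z) * max 0 (1 - (norm z)\<^sup>2))"
  have c: "continuous_on A f" "continuous_on A (partial_deriv i f)" for A
    using hpoly_continuous f hpoly_partial_deriv by blast+
  have z1: "max 0 (1 - (norm z)\<^sup>2) = 0" if "norm z \<ge> 1" for z :: "real^'n"
    using one_le_power[OF that, of 2] by simp
  have "(LINT z|lborel. F' z) = 0"
  proof (rule integral_directional_deriv_eq_0[where e = "axis i 1" and F = F])
    fix z :: "real^'n" and s
    let ?w = "z + s *\<^sub>R axis i 1"
    have "((\<lambda>t. 1 - (norm (z + t *\<^sub>R axis i 1))\<^sup>2) has_real_derivative - (2 * ?w $ i)) (at s)"
      using DERIV_diff[OF DERIV_const hpoly_DERIV[OF hpoly_norm_sq]]
      by (simp add: partial_deriv_norm_sq)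
    from DERIV_chain2[OF DERIV_max0_sq this]
    have "((\<lambda>t. (max 0 (1 - (norm (z + t *\<^sub>R axis i 1))\<^sup>2))\<^sup>2) has_real_derivative
      (2 * max 0 (1 - (norm ?w)\<^sup>2)) * - (2 * ?w $ i)) (at s)" .
    from DERIV_mult[OF hpoly_DERIV[OF f] this]
    show "((\<lambda>t. F (z + t *\<^sub>R axis i 1)) has_real_derivative F' ?w) (at s)"
      by (simp add: F_def F'_def algebra_simps)
  qed (auto simp: F_def F'_def z1 intro!: continuous_intros c)
  moreover have "F' z = indicator (ball 0 1) z * (partial_deriv i f z * norm z ^ 0)
       - 2 * (indicator (ball 0 1) z * (partial_deriv i f z * norm z ^ 2))
       + indicator (ball 0 1) z * (partial_deriv i f z * norm z ^ 4)
       - 4 * (indicator (ball 0 1) z * ((z $ i * f z) * norm z ^ 0))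
       + 4 * (indicator (ball 0 1) z * ((z $ i * f z) * norm z ^ 2))" for z
  proof (cases "norm z < 1")
    case True
    then have "(norm z)\<^sup>2 \<le> 1" by (simp add: power_le_one)
    then have "max 0 (1 - (norm z)\<^sup>2) = 1 - (norm z)\<^sup>2" by simp
    moreover have "norm z ^ 4 = ((norm z)\<^sup>2)\<^sup>2" by simp
    ultimately show ?thesis using True by (simp only: F'_def) (simp add: power2_eq_square algebra_simps)
  qed (simp add: F'_def z1)
  ultimately have "0 = (LINT z|lborel. indicator (ball 0 1) z * (partial_deriv i f z * norm z ^ 0)
       - 2 * (indicator (ball 0 1) z * (partial_deriv i f z * norm z ^ 2))
       + indicator (ball 0 1) z * (partial_deriv i f z * norm z ^ 4)
       - 4 * (indicator (ball 0 1) z * ((z $ i * f z) * norm z ^ 0))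
       + 4 * (indicator (ball 0 1) z * ((z $ i * f z) * norm z ^ 2)))" by simp
  also have "\<dots> = (LINT z|lborel. indicator (ball 0 1) z * (partial_deriv i f z * norm z ^ 0))
       - 2 * (LINT z|lborel. indicator (ball 0 1) z * (partial_deriv i f z * norm z ^ 2))
       + (LINT z|lborel. indicator (ball 0 1) z * (partial_deriv i f z * norm z ^ 4))
       - 4 * (LINT z|lborel. indicator (ball 0 1) z * ((z $ i * f z) * norm z ^ 0))
       + 4 * (LINT z|lborel. indicator (ball 0 1) z * ((z $ i * f z) * norm z ^ 2))"
  proof -
    have i: "integrable lborel (\<lambda>z. indicator (ball 0 1) z * h z)" if h: "continuous_on UNIV h" for h :: "real^'n \<Rightarrow> real"
    proof -
      have "integrable lborel (\<lambda>z. indicator (cball 0 1) z *\<^sub>R h z)"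
        using borel_integrable_compact[OF compact_cball continuous_on_subset[OF h]] by simp
      then show ?thesis
        by (rule Bochner_Integration.integrable_bound)
          (use borel_measurable_continuous_onI[OF h] in \<open>auto split: split_indicator\<close>)
    qed
    have "integrable lborel (\<lambda>z. indicator (ball 0 1) z * (partial_deriv i f z * norm z ^ p))"
      "integrable lborel (\<lambda>z. indicator (ball 0 1) z * ((z $ i * f z) * norm z ^ p))" for p
      by (auto intro!: i continuous_intros c)
    note this[of 0] this[of 2] this[of 4]
    then show ?thesis by simp
  qed
  finally have *: "0 = (LINT z|lborel. indicator (ball 0 1) z * (partial_deriv i f z * norm z ^ 0))
       - 2 * (LINT z|lborel. indicator (ball 0 1) z * (partial_deriv i f z * norm z ^ 2))
       + (LINT z|lborel. indicator (ball 0 1) z * (partial_deriv i f z * norm z ^ 4))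
       - 4 * (LINT z|lborel. indicator (ball 0 1) z * ((z $ i * f z) * norm z ^ 0))
       + 4 * (LINT z|lborel. indicator (ball 0 1) z * ((z $ i * f z) * norm z ^ 2))" .
  let ?P = "LINT z|sphere_measure. partial_deriv i f z" and ?Q = "LINT z|sphere_measure. z $ i * f z"
  \<comment> \<open>\<open>D\<close> is the degree of the derivative plus the dimension. The
    subtraction truncates for m = 0; there both integrals are shown to vanish separately.\<close>
  define D where "D = real (m - 1) + real CARD('n)"
  have D: "D > 0" by (simp add: D_def add_nonneg_pos)
  have Q: "0 = ?P / D - 2 * (?P / (D + 2)) + ?P / (D + 4)
       - 4 * (?Q / (real (Suc m) + real CARD('n))) + 4 * (?Q / (real (Suc m) + real CARD('n) + 2))"
    using * unfolding hpoly_ball_integral[OF hpoly_partial_deriv[OF f]] hpoly_ball_integral[OF hpoly.coord[OF f]]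
    by (simp add: D_def add_ac)
  show ?thesis
  proof (cases m)
    case 0
    then have "?P = 0" using hpoly_0_partial_deriv[OF f] by simp
    have "?Q = 0"
    proof (rule ccontr)
      assume "?Q \<noteq> 0"
      have "?Q / (1 + real CARD('n)) = ?Q / (3 + real CARD('n))"
        using Q 0 \<open>?P = 0\<close> by (simp add: add_ac)
      then show False using \<open>?Q \<noteq> 0\<close> by (simp add: field_simps)
    qed
    then show ?thesis using \<open>?P = 0\<close> by simp
  next
    case (Suc l)
    then have e: "real (Suc m) + real CARD('n) = D + 2" "real m + real CARD('n) - 1 = D"
      by (auto simp: D_def)
    have "D + 2 > 0" "D + 4 > 0" using D by auto
    have "0 = ?P / D - 2 * (?P / (D + 2)) + ?P / (D + 4) - 4 * (?Q / (D + 2)) + 4 * (?Q / (D + 4))"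
      using Q unfolding e by (simp add: add_ac)
    \<comment> \<open>1/D - 2/(D+2) + 1/(D+4) = 8 / (D(D+2)(D+4)) and 4/(D+2) - 4/(D+4) = 8 /
      ((D+2)(D+4)).\<close>
    also have "\<dots> = 8 * (?P - D * ?Q) / (D * (D + 2) * (D + 4))"
      using D \<open>D + 2 > 0\<close> \<open>D + 4 > 0\<close> by (simp add: divide_simps) (simp add: algebra_simps)
    finally have "?P = D * ?Q" using D \<open>D + 2 > 0\<close> \<open>D + 4 > 0\<close> by simp
    then show ?thesis unfolding e by simp
  qed
qed

subsection \<open>The Funk--Hecke formula for powers\<close>

lemma hpoly_integrable: "hpoly k f \<Longrightarrow> integrable sphere_measure f"
  by (intro integrable_sphere_measure hpoly_continuous)

text \<open>A Green identity: integrate \<open>f z * partial_deriv i g z\<close> by parts and sum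
  over i. Euler's identity produces k times g on the left, and the Laplacian of g drops out on the
  right. For k = 0 the degree k - 1 would be truncated, so that case is separate.\<close>

lemma sphere_integral_gradients:
  fixes f g :: "real^'n::finite \<Rightarrow> real"
  assumes f: "hpoly l f" and g: "g \<in> sph_harm k"
  shows "(real l + real k + real CARD('n) - 2) * real k * (LINT z|sphere_measure. f z * g z) =
    (\<Sum>i\<in>UNIV. LINT z|sphere_measure. partial_deriv i f z * partial_deriv i g z)"
proof (cases k)
  case 0
  have "hpoly k g" using g by (simp add: sph_harm_iff)
  then show ?thesis using 0 by (simp add: hpoly_0_partial_deriv)
next
  case (Suc k')
  have hg: "hpoly k g" and lap: "\<And>z. (\<Sum>i\<in>UNIV. partial_deriv i (partial_deriv i g) z) = 0"
    using g by (auto simp: sph_harm_iff)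
  note h1 = hpoly_partial_deriv[OF hg] and f1 = hpoly_partial_deriv[OF f]
  note h2 = hpoly_partial_deriv[OF h1]
  have step: "(real l + real k + real CARD('n) - 2) * (LINT z|sphere_measure. z $ i * (f z * partial_deriv i g z)) =
     (LINT z|sphere_measure. partial_deriv i f z * partial_deriv i g z) +
     (LINT z|sphere_measure. f z * partial_deriv i (partial_deriv i g) z)" for i
  proof -
    have "(real l + real k + real CARD('n) - 2) * (LINT z|sphere_measure. z $ i * (f z * partial_deriv i g z)) =
       (LINT z|sphere_measure. partial_deriv i (\<lambda>z. f z * partial_deriv i g z) z)"
      using sphere_integral_by_parts[OF hpoly_mult[OF f h1, of i], of i] Suc by (simp add: algebra_simps)
    also have "\<dots> = (LINT z|sphere_measure. partial_deriv i f z * partial_deriv i g z + f z * partial_deriv i (partial_deriv i g) z)"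
      by (simp add: partial_deriv_mult[OF f h1])
    also have "\<dots> = (LINT z|sphere_measure. partial_deriv i f z * partial_deriv i g z) +
     (LINT z|sphere_measure. f z * partial_deriv i (partial_deriv i g) z)"
      by (intro Bochner_Integration.integral_add hpoly_integrable[OF hpoly_mult[OF f1 h1]] hpoly_integrable[OF hpoly_mult[OF f h2]])
    finally show ?thesis .
  qed
  have "(\<Sum>i\<in>UNIV. LINT z|sphere_measure. z $ i * (f z * partial_deriv i g z)) =
      (LINT z|sphere_measure. (\<Sum>i\<in>UNIV. z $ i * (f z * partial_deriv i g z)))"
    by (intro Bochner_Integration.integral_sum[symmetric] hpoly_integrable[OF hpoly.coord[OF hpoly_mult[OF f h1]]])
  also have "\<dots> = (LINT z|sphere_measure. real k * (f z * g z))"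
  proof (rule Bochner_Integration.integral_cong)
    fix z
    have "(\<Sum>i\<in>UNIV. z $ i * (f z * partial_deriv i g z)) = f z * (\<Sum>i\<in>UNIV. z $ i * partial_deriv i g z)"
      by (simp add: sum_distrib_left mult.left_commute)
    then show "(\<Sum>i\<in>UNIV. z $ i * (f z * partial_deriv i g z)) = real k * (f z * g z)"
      by (simp add: hpoly_euler[OF hg])
  qed simp
  finally have A: "(\<Sum>i\<in>UNIV. LINT z|sphere_measure. z $ i * (f z * partial_deriv i g z)) =
    real k * (LINT z|sphere_measure. f z * g z)" by simp
  have "(\<Sum>i\<in>UNIV. LINT z|sphere_measure. f z * partial_deriv i (partial_deriv i g) z) =
      (LINT z|sphere_measure. (\<Sum>i\<in>UNIV. f z * partial_deriv i (partial_deriv i g) z))"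
    by (intro Bochner_Integration.integral_sum[symmetric] hpoly_integrable[OF hpoly_mult[OF f h2]])
  also have "\<dots> = 0" by (simp add: sum_distrib_left[symmetric] lap)
  finally have B: "(\<Sum>i\<in>UNIV. LINT z|sphere_measure. f z * partial_deriv i (partial_deriv i g) z) = 0" .
  have "(real l + real k + real CARD('n) - 2) * (\<Sum>i\<in>UNIV. LINT z|sphere_measure. z $ i * (f z * partial_deriv i g z)) =
    (\<Sum>i\<in>UNIV. LINT z|sphere_measure. partial_deriv i f z * partial_deriv i g z)"
    unfolding sum_distrib_left step sum.distrib B by simp
  then show ?thesis unfolding A by (simp add: mult.assoc)
qed

text \<open>The right-hand side of the Green identity is symmetric in f and g, so the two left-hand
  sides agree. Their difference carries the factor (l + k + d - 2) (k - l), which is nonzero for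
  distinct degrees once d >= 2.\<close>

lemma sph_harm_orthogonal:
  fixes f g :: "real^'n::finite \<Rightarrow> real"
  assumes "f \<in> sph_harm l" "g \<in> sph_harm k" "l \<noteq> k" "CARD('n) \<ge> 2"
  shows "(LINT z|sphere_measure. f z * g z) = 0"
proof -
  let ?I = "LINT z|sphere_measure. f z * g z"
  have "hpoly l f" "hpoly k g" using assms by (auto simp: sph_harm_iff)
  from sphere_integral_gradients[OF this(1) assms(2)] sphere_integral_gradients[OF this(2) assms(1)]
  have "(real l + real k + real CARD('n) - 2) * (real k - real l) * ?I = 0"
    by (simp add: mult.commute[of "g _"] mult.commute[of "partial_deriv _ g _"] algebra_simps)
  moreover have "real l + real k + real CARD('n) - 2 > 0" using assms by linarith
  ultimately show ?thesis using assms(3) by simp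
qed

text \<open>The Funk-Hecke eigenvalue of the n-th power in degree k, divided by the total surface
  measure. It vanishes unless n - k is even and nonnegative, because the power contains only
  harmonics of degrees n, n - 2, and so on.\<close>

definition fh_coeff :: "real \<Rightarrow> nat \<Rightarrow> nat \<Rightarrow> real" where
  "fh_coeff d n k = (if k \<le> n \<and> even (n - k)
     then fact n / (2 ^ n * fact ((n - k) div 2) * pochhammer (d / 2) ((n + k) div 2)) else 0)"

lemma fh_coeff_even:
  "fh_coeff d (k + 2 * j) k = fact (k + 2 * j) / (2 ^ (k + 2 * j) * fact j * pochhammer (d / 2) (k + j))"
proof -
  have "(k + 2 * j + k) div 2 = k + j" by presburger
  then show ?thesis by (simp add: fh_coeff_def)
qed

lemma fh_coeff_eq_0: "\<nexists>j. n = k + 2 * j \<Longrightarrow> fh_coeff d n k = 0"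
  unfolding fh_coeff_def by (metis evenE le_add_diff_inverse)

lemma fh_coeff_0: "fh_coeff d 0 k = (if k = 0 then 1 else 0)"
  by (simp add: fh_coeff_def)

lemma fh_coeff_nonneg: "d > 0 \<Longrightarrow> fh_coeff d n k \<ge> 0"
  by (auto simp: fh_coeff_def intro!: divide_nonneg_nonneg mult_nonneg_nonneg pochhammer_nonneg)

lemma fh_coeff_pos: "d > 0 \<Longrightarrow> fh_coeff d k k > 0"
  using fh_coeff_even[of d k 0] by (simp add: pochhammer_pos)

text \<open>The recursion that integration by parts will produce. Truncated \<open>m - 1\<close> and
  \<open>k - 1\<close> are multiplied by m = 0 and k = 0. If the parity or order of the indices is
  wrong, both sides vanish; on the boundary \<open>k = Suc m\<close> only the second term
  survives.\<close>

lemma fh_coeff_rec: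
  assumes d: "d > 0"
  shows "(real m + real k + d - 1) * fh_coeff d (Suc m) k =
    real m * fh_coeff d (m - 1) k + real k * fh_coeff d m (k - 1)"
proof (cases "\<exists>j. Suc m = k + 2 * j")
  case False
  have "real m * fh_coeff d (m - 1) k = 0"
  proof (cases m)
    case (Suc l)
    have "\<nexists>j. l = k + 2 * j" using False Suc by (metis add_Suc_right mult_Suc_right add_2_eq_Suc add.left_commute)
    then show ?thesis using Suc by (simp add: fh_coeff_eq_0)
  qed simp
  moreover have "real k * fh_coeff d m (k - 1) = 0"
  proof (cases k)
    case (Suc l)
    have "\<nexists>j. m = l + 2 * j" using False Suc by auto
    then show ?thesis using Suc by (simp add: fh_coeff_eq_0)
  qed simp
  ultimately show ?thesis using fh_coeff_eq_0[OF False, of d] by auto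
next
  case True
  then obtain j where j: "Suc m = k + 2 * j" by blast
  have pp: "pochhammer (d/2) n > 0" for n using d by (simp add: pochhammer_pos)
  show ?thesis
  proof (cases j)
    case 0
    then have k: "k = Suc m" using j by simp
    define E where "E = d / 2 + real m"
    have E: "E > 0" using d by (simp add: E_def add_pos_nonneg)
    have 1: "fh_coeff d (m - 1) k = 0" by (simp add: k fh_coeff_def)
    have 2: "fh_coeff d m (k - 1) = fact m / (2 ^ m * pochhammer (d / 2) m)"
      using fh_coeff_even[of d m 0] by (simp add: k)
    have 3: "fh_coeff d (Suc m) k = (real m + 1) * fact m / (2 * 2 ^ m * (pochhammer (d / 2) m * E))"
      using fh_coeff_even[of d "Suc m" 0] by (simp add: k pochhammer_Suc E_def add_ac)
    have e: "real m + real k + d - 1 = 2 * E" by (simp add: k E_def)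
    show ?thesis unfolding 1 2 3 e using pp[of m] E by (simp add: k field_simps)
  next
    case (Suc i)
    then have m: "m = Suc (k + 2 * i)" using j by simp
    define P where "P = pochhammer (d / 2) (k + i)"
    have P: "P > 0" using pp by (simp add: P_def)
    \<comment> \<open>\<open>E\<close> is the last Pochhammer factor of
      \<open>fh_coeff d (Suc m) k\<close>, and the factor on the left of the recursion is 2
      E.\<close>
    define E where "E = d / 2 + real (k + i)"
    have E: "E > 0" using d by (simp add: E_def add_pos_nonneg)
    define F where "F = (fact (k + 2 * i) :: real)"
    have 1: "fh_coeff d (m - 1) k = F / (2 ^ (k + 2 * i) * fact i * P)"
      using fh_coeff_even[of d k i] by (simp add: m P_def F_def)
    have 2: "real k * fh_coeff d m (k - 1) = real k * ((real (k + 2 * i) + 1) * F) / (2 * 2 ^ (k + 2 * i) * ((real i + 1) * fact i) * P)"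
    proof (cases k)
      case (Suc l)
      show ?thesis using fh_coeff_even[of d l "Suc i"] Suc by (simp add: m P_def F_def add_ac)
    qed simp
    have 3: "fh_coeff d (Suc m) k = (real (k + 2 * i) + 2) * ((real (k + 2 * i) + 1) * F) / (4 * 2 ^ (k + 2 * i) * ((real i + 1) * fact i) * (P * E))"
      using fh_coeff_even[of d k "Suc i"] by (simp add: m P_def F_def E_def pochhammer_Suc add_ac)
    have e: "real m + real k + d - 1 = 2 * E" by (simp add: m E_def)
    have mr: "real m = real (k + 2 * i) + 1" by (simp add: m)
    define T where "T = (2::real) ^ (k + 2 * i)"
    define I where "I = (fact i :: real)"
    have TI: "T > 0" "I > 0" "real i + 1 > 0" by (auto simp: T_def I_def)
    show ?thesis
      unfolding e unfolding 1 2 3 mr T_def[symmetric] I_def[symmetric] using TI P E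
      by (simp add: divide_simps) (simp add: algebra_simps)
  qed
qed

text \<open>In the recursion the weights m and k add up to at most m + k + d - 1. The bound lets the
  Taylor coefficients alone dominate the eigenvalue series. For m + k = 0 the left factor may be 0,
  so that case is checked directly.\<close>

lemma fh_coeff_le_1:
  assumes d: "d \<ge> 1"
  shows "fh_coeff d n k \<le> 1"
proof (induction n arbitrary: k rule: less_induct)
  case (less n)
  show ?case
  proof (cases n)
    case 0
    then show ?thesis by (simp add: fh_coeff_0)
  next
    case (Suc m)
    show ?thesis
    proof (cases "m + k = 0")
      case True
      then show ?thesis using Suc by (simp add: fh_coeff_def)
    next
      case False
      have "(real m + real k + d - 1) * fh_coeff d n k = real m * fh_coeff d (m - 1) k + real k * fh_coeff d m (k - 1)"
        using fh_coeff_rec[of d m k] d Suc by simp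
      also have "\<dots> \<le> real m * 1 + real k * 1"
        using less.IH[of "m - 1" k] less.IH[of m "k - 1"] Suc by (intro add_mono mult_left_mono) auto
      also have "\<dots> \<le> (real m + real k + d - 1) * 1" using d by simp
      finally show ?thesis
        by (rule mult_left_le_imp_le) (use False d in linarith)
    qed
  qed
qed

lemma partial_deriv_power:
  "hpoly k f \<Longrightarrow> partial_deriv i (\<lambda>z. f z ^ n) = (\<lambda>z. real n * f z ^ (n - 1) * partial_deriv i f z)"
proof
  fix z assume "hpoly k f"
  then show "partial_deriv i (\<lambda>z. f z ^ n) z = real n * f z ^ (n - 1) * partial_deriv i f z"
    using DERIV_power[OF hpoly_DERIV0[of k f z i], of n] by (intro partial_derivI) (simp add: mult_ac)
qed

lemma hpoly_inner_power: "hpoly n (\<lambda>z. (x \<bullet> z) ^ n)"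
  using hpoly_power[OF hpoly_inner, of n x] by simp

text \<open>The Funk--Hecke formula for the zonal kernels \<open>(x \<bullet> z) ^ n\<close>, by induction on \<open>n\<close>:
  integrating by parts against one factor \<open>x \<bullet> z\<close> lowers \<open>n\<close>, and derivatives of spherical
  harmonics are again spherical harmonics.\<close>

lemma funk_hecke_power:
  fixes x :: "real^'n::finite"
  assumes x: "norm x = 1" and d2: "CARD('n) \<ge> 2"
  shows "Y \<in> sph_harm k \<Longrightarrow> (LINT z|sphere_measure. (x \<bullet> z) ^ n * Y z) =
    measure (sphere_measure :: (real^'n) measure) UNIV * fh_coeff (real CARD('n)) n k * Y x"
proof (induction n arbitrary: k Y rule: less_induct)
  case (less n)
  let ?S = "measure (sphere_measure :: (real^'n) measure) UNIV" and ?d = "real CARD('n)"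
  have Y: "hpoly k Y" using less.prems by (simp add: sph_harm_iff)
  show ?case
  proof (cases n)
    case 0
    show ?thesis
    proof (cases "k = 0")
      case True
      have c: "Y z = Y 0" for z using hpoly_scaleR[OF Y, of 0 z] True by simp
      have "(LINT z|sphere_measure. Y z) = (\<integral>z. Y 0 \<partial>(sphere_measure :: (real^'n) measure))"
        by (intro Bochner_Integration.integral_cong refl c)
      then show ?thesis using 0 True c[of x] by (simp add: fh_coeff_0)
    next
      case False
      have "(\<lambda>_. 1) \<in> sph_harm 0" by (simp add: sph_harm_iff partial_deriv_const hpoly.const)
      from sph_harm_orthogonal[OF this less.prems] False d2
      show ?thesis using 0 by (simp add: fh_coeff_0)
    qed
  next
    case (Suc m)
    define f where "f = (\<lambda>z. (x \<bullet> z) ^ m * Y z)"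
    have f: "hpoly (m + k) f" unfolding f_def by (intro hpoly_mult hpoly_inner_power Y)
    have D: "partial_deriv i f z = (real m * x $ i) * ((x \<bullet> z) ^ (m - 1) * Y z) + (x \<bullet> z) ^ m * partial_deriv i Y z" for i z
      unfolding f_def partial_deriv_mult[OF hpoly_inner_power Y] partial_deriv_power[OF hpoly_inner] partial_deriv_inner
      by simp
    have S2: "real m * (LINT z|sphere_measure. (x \<bullet> z) ^ (m - 1) * Y z) = real m * (?S * fh_coeff ?d (m - 1) k * Y x)"
      using less.IH[of "m - 1" Y k] less.prems Suc by (cases m) auto
    have S1: "(LINT z|sphere_measure. (x \<bullet> z) ^ m * partial_deriv i Y z) = ?S * fh_coeff ?d m (k - 1) * partial_deriv i Y x" for i
      using less.IH[of m _ "k - 1"] sph_harm_partial_deriv[OF less.prems] Suc by auto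
    have P: "(real m + real k + ?d - 1) * (LINT z|sphere_measure. z $ i * f z) =
      x $ i * (real m * (?S * fh_coeff ?d (m - 1) k * Y x)) + ?S * fh_coeff ?d m (k - 1) * partial_deriv i Y x" for i
    proof -
      have "(real m + real k + ?d - 1) * (LINT z|sphere_measure. z $ i * f z) = (LINT z|sphere_measure. partial_deriv i f z)"
        using sphere_integral_by_parts[OF f, of i] by simp
      also have "\<dots> = (real m * x $ i) * (LINT z|sphere_measure. (x \<bullet> z) ^ (m - 1) * Y z) + (LINT z|sphere_measure. (x \<bullet> z) ^ m * partial_deriv i Y z)"
        unfolding D
        by (subst Bochner_Integration.integral_add)
          (auto intro!: integrable_mult_right hpoly_integrable[OF hpoly_mult[OF hpoly_inner_power Y]]
             hpoly_integrable[OF hpoly_mult[OF hpoly_inner_power hpoly_partial_deriv[OF Y]]])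
      also have "(real m * x $ i) * (LINT z|sphere_measure. (x \<bullet> z) ^ (m - 1) * Y z) = x $ i * (real m * (?S * fh_coeff ?d (m - 1) k * Y x))"
        using S2 by (auto simp: mult_ac)
      finally show ?thesis unfolding S1 .
    qed
    have "(LINT z|sphere_measure. (x \<bullet> z) ^ n * Y z) = (LINT z|sphere_measure. (\<Sum>i\<in>UNIV. x $ i * (z $ i * f z)))"
      by (simp add: Suc f_def inner_vec_def sum_distrib_right mult.assoc)
    also have "\<dots> = (\<Sum>i\<in>UNIV. x $ i * (LINT z|sphere_measure. z $ i * f z))"
      by (subst Bochner_Integration.integral_sum)
        (auto intro!: integrable_mult_right hpoly_integrable[OF hpoly.coord[OF f]])
    finally have "(real m + real k + ?d - 1) * (LINT z|sphere_measure. (x \<bullet> z) ^ n * Y z) =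
        (\<Sum>i\<in>UNIV. x $ i * ((real m + real k + ?d - 1) * (LINT z|sphere_measure. z $ i * f z)))"
      by (simp add: sum_distrib_left mult.left_commute)
    \<comment> \<open>Contracting with x gives |x|^2 = 1 in the first term and Euler's identity at x
      in the second; what remains is the right-hand side of \<open>fh_coeff_rec\<close>.\<close>
    also have "\<dots> = (\<Sum>i\<in>UNIV. x $ i * x $ i) * (real m * (?S * fh_coeff ?d (m - 1) k * Y x))
         + ?S * fh_coeff ?d m (k - 1) * (\<Sum>i\<in>UNIV. x $ i * partial_deriv i Y x)"
      unfolding P by (simp add: distrib_left sum.distrib sum_distrib_left sum_distrib_right mult_ac)
    also have "(\<Sum>i\<in>UNIV. x $ i * x $ i) = 1"
      using x by (simp add: norm_eq_1 inner_vec_def)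
    also have "(\<Sum>i\<in>UNIV. x $ i * partial_deriv i Y x) = real k * Y x" by (rule hpoly_euler[OF Y])
    also have "1 * (real m * (?S * fh_coeff ?d (m - 1) k * Y x)) + ?S * fh_coeff ?d m (k - 1) * (real k * Y x)
        = (real m * fh_coeff ?d (m - 1) k + real k * fh_coeff ?d m (k - 1)) * ?S * Y x"
      by (simp add: algebra_simps)
    also have "\<dots> = (real m + real k + ?d - 1) * (?S * fh_coeff ?d n k * Y x)"
      using fh_coeff_rec[of ?d m k] d2 Suc by (simp add: mult_ac)
    finally show ?thesis using d2 by (simp add: add_nonneg_eq_0_iff)
  qed
qed

subsection \<open>Zonal harmonics and expansions\<close>

text \<open>\<open>A\<close>, \<open>B\<close>, \<open>C\<close> are the three terms of the
  Laplacian of a product. The result stays in the span of products of the same shape, so harmonicity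
  becomes a two-term recursion on coefficients. The truncated exponents occur only with factor
  0.\<close>

lemma laplacian_inner_power_norm_power:
  fixes x z :: "real^'n::finite"
  assumes x: "norm x = 1"
  shows "(\<Sum>i\<in>UNIV. partial_deriv i (partial_deriv i (\<lambda>z. (x \<bullet> z) ^ m * ((norm z)\<^sup>2) ^ p)) z) =
    real m * (real m - 1) * (x \<bullet> z) ^ (m - 2) * ((norm z)\<^sup>2) ^ p +
    2 * real p * (2 * real p - 2 + real CARD('n) + 2 * real m) * (x \<bullet> z) ^ m * ((norm z)\<^sup>2) ^ (p - 1)"
proof -
  let ?a = "\<lambda>m z. (x \<bullet> z) ^ m" and ?b = "\<lambda>p z::real^'n. ((norm z)\<^sup>2) ^ p"
  have hb: "hpoly (p * 2) (?b p)" for p using hpoly_power[OF hpoly_norm_sq, of p] .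
  have da: "partial_deriv i (?a m) = (\<lambda>z. (real m * x $ i) * ?a (m - 1) z)" for i m
    by (simp add: partial_deriv_power[OF hpoly_inner] partial_deriv_inner mult_ac)
  have db: "partial_deriv i (?b p) = (\<lambda>z. (2 * real p) * (z $ i * ?b (p - 1) z))" for i p
    by (simp add: partial_deriv_power[OF hpoly_norm_sq] partial_deriv_norm_sq mult_ac)
  have dda: "partial_deriv i (partial_deriv i (?a m)) = (\<lambda>z. (real m * (real m - 1) * (x $ i)\<^sup>2) * ?a (m - 2) z)" for i
    unfolding da partial_deriv_cmult[OF hpoly_inner_power] 
    by (cases m) (auto simp: power2_eq_square numeral_2_eq_2 mult_ac)
  have ddb: "partial_deriv i (partial_deriv i (?b p)) =
     (\<lambda>z. (2 * real p) * (?b (p - 1) z + (2 * real (p - 1)) * ((z $ i)\<^sup>2 * ?b (p - 2) z)))" for i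
    unfolding db partial_deriv_cmult[OF hpoly.coord[OF hb]] partial_deriv_coord[OF hb]
    by (auto simp: power2_eq_square mult_ac numeral_2_eq_2)
  have pd: "partial_deriv i (\<lambda>z. ?a m z * ?b p z) = (\<lambda>z. partial_deriv i (?a m) z * ?b p z + ?a m z * partial_deriv i (?b p) z)" for i
    by (rule partial_deriv_mult[OF hpoly_inner_power hb])
  note h1 = hpoly_mult[OF hpoly_partial_deriv[OF hpoly_inner_power] hb]
  note h2 = hpoly_mult[OF hpoly_inner_power hpoly_partial_deriv[OF hb]]
  have pdd: "partial_deriv i (partial_deriv i (\<lambda>z. ?a m z * ?b p z)) z =
      partial_deriv i (partial_deriv i (?a m)) z * ?b p z + 2 * (partial_deriv i (?a m) z * partial_deriv i (?b p) z)
      + ?a m z * partial_deriv i (partial_deriv i (?b p)) z" for i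
    unfolding pd partial_deriv_add[OF h1 h2]
      partial_deriv_mult[OF hpoly_partial_deriv[OF hpoly_inner_power] hb]
      partial_deriv_mult[OF hpoly_inner_power hpoly_partial_deriv[OF hb]] by simp
  have sx: "(\<Sum>i\<in>UNIV. (x $ i)\<^sup>2) = 1" using x by (simp add: norm_eq_1 inner_vec_def power2_eq_square)
  have sz: "(\<Sum>i\<in>UNIV. (z $ i)\<^sup>2) = (norm z)\<^sup>2" unfolding power2_norm_eq_inner inner_vec_def by (simp add: power2_eq_square)
  have sxz: "(\<Sum>i\<in>UNIV. x $ i * z $ i) = x \<bullet> z" by (simp add: inner_vec_def)
  have A: "(\<Sum>i\<in>UNIV. partial_deriv i (partial_deriv i (?a m)) z * ?b p z) = real m * (real m - 1) * ?a (m - 2) z * ?b p z"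
  proof -
    have "(\<Sum>i\<in>UNIV. partial_deriv i (partial_deriv i (?a m)) z * ?b p z) = (\<Sum>i\<in>UNIV. (x $ i)\<^sup>2) * (real m * (real m - 1) * ?a (m - 2) z * ?b p z)"
      unfolding dda sum_distrib_right by (simp add: mult_ac)
    then show ?thesis by (simp add: sx)
  qed
  have B: "(\<Sum>i\<in>UNIV. 2 * (partial_deriv i (?a m) z * partial_deriv i (?b p) z)) = 4 * real m * real p * ?a m z * ?b (p - 1) z"
  proof -
    have "(\<Sum>i\<in>UNIV. 2 * (partial_deriv i (?a m) z * partial_deriv i (?b p) z)) =
      (\<Sum>i\<in>UNIV. x $ i * z $ i) * (4 * real m * real p * ?a (m - 1) z * ?b (p - 1) z)"
      unfolding da db sum_distrib_right by (simp add: mult_ac)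
    then show ?thesis by (cases m) (simp_all add: sxz mult_ac)
  qed
  have C: "(\<Sum>i\<in>UNIV. ?a m z * partial_deriv i (partial_deriv i (?b p)) z) =
      2 * real p * (2 * real p - 2 + real CARD('n)) * ?a m z * ?b (p - 1) z"
  proof -
    have 1: "(\<Sum>i\<in>UNIV. ?a m z * partial_deriv i (partial_deriv i (?b p)) z) =
      ?a m z * (2 * real p * (real CARD('n) * ?b (p - 1) z)) +
      ?a m z * (2 * real p * (2 * real (p - 1) * ((\<Sum>i\<in>UNIV. (z $ i)\<^sup>2) * ?b (p - 2) z)))"
      unfolding ddb by (simp add: sum_distrib_left[symmetric] sum_distrib_right[symmetric] sum.distrib distrib_left)
    have 2: "2 * real p * (2 * real (p - 1) * ((norm z)\<^sup>2 * ?b (p - 2) z)) = 2 * real p * (2 * real p - 2) * ?b (p - 1) z"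
    proof (cases p)
      case (Suc q)
      then show ?thesis by (cases q) auto
    qed simp
    show ?thesis unfolding 1 sz 2 by (simp add: algebra_simps)
  qed
  show ?thesis unfolding pdd sum.distrib A B C by (simp add: algebra_simps)
qed

text \<open>Chosen so that the Laplacians of neighbouring summands of \<open>zonal\<close> cancel.
  Up to normalisation, \<open>zonal\<close> is the homogenised Gegenbauer (Legendre) polynomial of
  degree k in dimension d; its leading coefficient is 1.\<close>

primrec zonal_coeff :: "real \<Rightarrow> nat \<Rightarrow> nat \<Rightarrow> real" where
  "zonal_coeff d k 0 = 1"
| "zonal_coeff d k (Suc i) = - zonal_coeff d k i * (real (k - 2 * i) * (real (k - 2 * i) - 1)) /
     (2 * real (Suc i) * (2 * real (Suc i) - 2 + d + 2 * real (k - 2 * Suc i)))"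

definition zonal :: "nat \<Rightarrow> real^'n::finite \<Rightarrow> real^'n \<Rightarrow> real" where
  "zonal k x z = (\<Sum>i\<le>k div 2. zonal_coeff (real CARD('n)) k i * ((x \<bullet> z) ^ (k - 2 * i) * ((norm z)\<^sup>2) ^ i))"

lemma zonal_sph_harm:
  fixes x :: "real^'n::finite"
  assumes x: "norm x = 1"
  shows "zonal k x \<in> sph_harm k"
proof -
  let ?d = "real CARD('n)" and ?K = "k div 2"
  let ?e = "zonal_coeff ?d k"
  define w where "w = (\<lambda>i z::real^'n. (x \<bullet> z) ^ (k - 2 * i) * ((norm z)\<^sup>2) ^ i)"
  have w: "hpoly k (w i)" if "i \<le> ?K" for i
  proof -
    have "hpoly ((k - 2 * i) + i * 2) (w i)"
      unfolding w_def by (intro hpoly_mult hpoly_inner_power hpoly_power hpoly_norm_sq)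
    moreover have "(k - 2 * i) + i * 2 = k" using that by linarith
    ultimately show ?thesis by simp
  qed
  have z: "zonal k x = (\<lambda>z. \<Sum>i\<le>?K. ?e i * w i z)" by (simp add: zonal_def w_def fun_eq_iff)
  have h: "hpoly k (zonal k x)" unfolding z by (intro hpoly_sum hpoly_cmult w) auto
  have "(\<Sum>j\<in>UNIV. partial_deriv j (partial_deriv j (zonal k x)) z) = 0" for z
  proof -
    define A where "A = (\<lambda>i. real (k - 2 * i) * (real (k - 2 * i) - 1))"
    define v where "v = (\<lambda>i. (x \<bullet> z) ^ (k - 2 * i - 2) * ((norm z)\<^sup>2) ^ i)"
    define B where "B = (\<lambda>i. 2 * real i * (2 * real i - 2 + ?d + 2 * real (k - 2 * i)))"
    define v' where "v' = (\<lambda>i. (x \<bullet> z) ^ (k - 2 * i) * ((norm z)\<^sup>2) ^ (i - 1))"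
    have 1: "partial_deriv j (zonal k x) = (\<lambda>z. \<Sum>i\<le>?K. ?e i * partial_deriv j (w i) z)" for j
    proof -
      have "partial_deriv j (zonal k x) = (\<lambda>z. \<Sum>i\<le>?K. partial_deriv j (\<lambda>z. ?e i * w i z) z)"
        unfolding z by (rule partial_deriv_sum[where k = k]) (auto intro!: hpoly_cmult w)
      then show ?thesis using partial_deriv_cmult[OF w] by (auto simp: fun_eq_iff intro!: sum.cong)
    qed
    have 2: "partial_deriv j (partial_deriv j (zonal k x)) z = (\<Sum>i\<le>?K. ?e i * partial_deriv j (partial_deriv j (w i)) z)" for j
    proof -
      have "partial_deriv j (partial_deriv j (zonal k x)) = (\<lambda>z. \<Sum>i\<le>?K. partial_deriv j (\<lambda>z. ?e i * partial_deriv j (w i) z) z)"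
        unfolding 1 by (rule partial_deriv_sum[where k = "k - 1"]) (auto simp del: One_nat_def intro!: hpoly_cmult hpoly_partial_deriv w)
      then show ?thesis using partial_deriv_cmult[OF hpoly_partial_deriv[OF w]] by (auto intro!: sum.cong)
    qed
    have "(\<Sum>j\<in>UNIV. partial_deriv j (partial_deriv j (zonal k x)) z) = (\<Sum>i\<le>?K. ?e i * (\<Sum>j\<in>UNIV. partial_deriv j (partial_deriv j (w i)) z))"
      unfolding 2 sum_distrib_left by (rule sum.swap)
    also have "\<dots> = (\<Sum>i\<le>?K. ?e i * (A i * v i + B i * v' i))"
      unfolding w_def laplacian_inner_power_norm_power[OF x] A_def B_def v_def v'_def by (simp add: mult_ac)
    \<comment> \<open>The sum telescopes: the \<open>B\<close> part of each summand cancels the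
      \<open>A\<close> part of the preceding one. The last \<open>A\<close> vanishes because the
      remaining exponent \<open>k - 2 * ?K\<close> is 0 or 1.\<close>
    also have "\<dots> = ?e ?K * A ?K * v ?K"
    proof -
      have "(\<Sum>i\<le>J. ?e i * (A i * v i + B i * v' i)) = ?e J * A J * v J" if "J \<le> ?K" for J
        using that
      proof (induction J)
        case 0
        then show ?case by (simp add: B_def)
      next
        case (Suc J)
        have "B (Suc J) \<noteq> 0" by (simp add: B_def add_nonneg_eq_0_iff)
        moreover have "?e (Suc J) = - ?e J * A J / B (Suc J)" by (simp add: A_def B_def)
        ultimately have "?e (Suc J) * B (Suc J) = - ?e J * A J" by simp
        moreover have "v' (Suc J) = v J" by (simp add: v_def v'_def diff_diff_add)
        ultimately show ?case using Suc by (simp add: distrib_left mult.assoc[symmetric] del: zonal_coeff.simps)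
      qed
      then show ?thesis by simp
    qed
    also have "A ?K = 0"
    proof -
      have "k - 2 * ?K = 0 \<or> k - 2 * ?K = 1" by linarith
      then show ?thesis by (auto simp: A_def)
    qed
    finally show ?thesis by simp
  qed
  with h show ?thesis by (simp add: sph_harm_iff)
qed

lemma sphere_integral_cong:
  assumes "\<And>z. z \<in> sphere 0 1 \<Longrightarrow> f z = g z" "continuous_on UNIV f" "continuous_on UNIV g"
  shows "(LINT z|sphere_measure. f z) = (LINT z|sphere_measure. g z :: real)"
proof (rule integral_cong_AE)
  show "AE z in sphere_measure. f z = g z" using AE_sphere_measure by eventually_elim (rule assms)
  show "f \<in> borel_measurable sphere_measure" "g \<in> borel_measurable sphere_measure"
    using assms(2,3) by (auto dest: borel_measurable_continuous_onI)
qed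

section \<open>Finite expansions in an arbitrary orthonormal basis of harmonics\<close>

locale harmonic_basis =
  fixes N :: "nat \<Rightarrow> nat" and Y :: "nat \<Rightarrow> nat \<Rightarrow> real^'n::finite \<Rightarrow> real"
  assumes onb: "\<And>k. sph_harm_onb k (N k) (Y k)" and d2: "CARD('n) \<ge> 2"
begin

text \<open>The coefficients are prescribed as integrals rather than merely asserted to exist, so
  that the Funk-Hecke formula can evaluate them afterwards. Equality is required only on the sphere,
  where powers of the norm disappear.\<close>

definition expands :: "nat \<Rightarrow> (real^'n \<Rightarrow> real) \<Rightarrow> bool" where
  "expands n f \<longleftrightarrow> continuous_on UNIV f \<and> (\<forall>z\<in>sphere 0 1.
     f z = (\<Sum>k\<le>n. \<Sum>j<N k. (LINT y|sphere_measure. f y * Y k j y) * Y k j z))"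

lemma Y_harm: "j < N k \<Longrightarrow> Y k j \<in> sph_harm k"
  using onb by (auto simp: sph_harm_onb_def)

lemma Y_cont: "j < N k \<Longrightarrow> continuous_on A (Y k j)"
  using Y_harm hpoly_continuous sph_harm_iff by blast

lemma expands_cong:
  assumes f: "expands n f" and g: "continuous_on UNIV g" and eq: "\<And>z. z \<in> sphere 0 1 \<Longrightarrow> g z = f z"
  shows "expands n g"
proof -
  have "(LINT y|sphere_measure. g y * Y k j y) = (LINT y|sphere_measure. f y * Y k j y)" if "j < N k" for k j
    using f g that by (intro sphere_integral_cong) (auto simp: eq expands_def intro!: continuous_intros Y_cont)
  then show ?thesis using f g eq by (simp add: expands_def)
qed

lemma expands_add_cmult:
  assumes f: "expands n f" and g: "expands n g"
  shows "expands n (\<lambda>z. f z + a * g z)"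
proof -
  have c: "continuous_on UNIV f" "continuous_on UNIV g" using f g by (auto simp: expands_def)
  have "(LINT y|sphere_measure. (f y + a * g y) * Y k j y) =
      (LINT y|sphere_measure. f y * Y k j y) + a * (LINT y|sphere_measure. g y * Y k j y)" if "j < N k" for k j
  proof -
    have "integrable sphere_measure (\<lambda>y. f y * Y k j y)" "integrable sphere_measure (\<lambda>y. g y * Y k j y)"
      using that by (auto intro!: integrable_sphere_measure continuous_intros c Y_cont)
    then show ?thesis by (simp add: distrib_right mult.assoc)
  qed
  then show ?thesis using f g unfolding expands_def
    by (auto intro!: continuous_intros simp: distrib_right sum.distrib sum_distrib_left mult.assoc)
qed

text \<open>Other degrees contribute nothing by orthogonality; within degree l, orthonormality
  identifies the unknown coefficients \<open>a\<close> with the integrals.\<close>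

lemma expands_sph_harm:
  assumes h: "h \<in> sph_harm l" and l: "l \<le> n"
  shows "expands n h"
proof -
  have hc: "continuous_on UNIV h" using h hpoly_continuous by (auto simp: sph_harm_iff)
  obtain a where a: "\<And>z. z \<in> sphere 0 1 \<Longrightarrow> h z = (\<Sum>j<N l. a j * Y l j z)"
    using onb[of l] h unfolding sph_harm_onb_def by blast
  have "(LINT y|sphere_measure. h y * Y k j y) = (if k = l then a j else 0)" if j: "j < N k" for k j
  proof (cases "k = l")
    case False
    then show ?thesis using sph_harm_orthogonal[OF h Y_harm[OF j]] d2 by simp
  next
    case True
    have "(LINT y|sphere_measure. h y * Y k j y) = (LINT y|sphere_measure. (\<Sum>i<N l. a i * (Y l i y * Y l j y)))"
      using j True by (intro sphere_integral_cong)
        (auto simp: a sum_distrib_right mult.assoc intro!: continuous_intros Y_cont hc)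
    also have "\<dots> = (\<Sum>i<N l. a i * (LINT y|sphere_measure. Y l i y * Y l j y))"
      by (subst Bochner_Integration.integral_sum)
        (use j True in \<open>auto intro!: integrable_sphere_measure continuous_intros Y_cont\<close>)
    also have "\<dots> = (\<Sum>i<N l. if i = j then a i else 0)"
      using onb[of l] j True by (intro sum.cong) (auto simp: sph_harm_onb_def)
    also have "\<dots> = a j" using j True by simp
    finally show ?thesis using True by simp
  qed
  then have "(\<Sum>k\<le>n. \<Sum>j<N k. (LINT y|sphere_measure. h y * Y k j y) * Y k j z) =
     (\<Sum>k\<le>n. if k = l then (\<Sum>j<N l. a j * Y l j z) else 0)" for z
    by (intro sum.cong) auto
  then show ?thesis using a l hc by (simp add: expands_def)
qed

text \<open>On the sphere \<open>zonal m x z\<close> is the m-th power of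
  \<open>x \<bullet> z\<close> plus lower powers, by its leading coefficient 1. The lower powers
  expand by induction, the zonal harmonic by the previous lemma.\<close>

lemma expands_inner_power:
  fixes x :: "real^'n"
  assumes x: "norm x = 1"
  shows "m \<le> n \<Longrightarrow> expands n (\<lambda>z. (x \<bullet> z) ^ m)"
proof (induction m rule: less_induct)
  case (less m)
  let ?e = "zonal_coeff (real CARD('n)) m"
  have "expands n (\<lambda>z. zonal m x z - (\<Sum>i\<in>{1..J}. ?e i * (x \<bullet> z) ^ (m - 2 * i)))" if "J \<le> m div 2" for J
    using that
  proof (induction J)
    case 0
    then show ?case using expands_sph_harm[OF zonal_sph_harm[OF x] less.prems] by simp
  next
    case (Suc J)
    have "m - 2 * Suc J < m" "m - 2 * Suc J \<le> n" using Suc.prems less.prems by auto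
    from expands_add_cmult[OF Suc.IH less.IH[OF this], of "- ?e (Suc J)"]
    show ?case using Suc.prems by (simp add: algebra_simps del: zonal_coeff.simps)
  qed
  from this[of "m div 2"] show ?case
  proof (rule expands_cong)
    fix z :: "real^'n" assume "z \<in> sphere 0 1"
    then have "zonal m x z = (\<Sum>i\<le>m div 2. ?e i * (x \<bullet> z) ^ (m - 2 * i))" by (simp add: zonal_def)
    also have "\<dots> = (x \<bullet> z) ^ m + (\<Sum>i\<in>{1..m div 2}. ?e i * (x \<bullet> z) ^ (m - 2 * i))"
      by (simp add: sum.atMost_shift sum.atLeast1_atMost_eq lessThan_Suc_atMost del: zonal_coeff.simps(2))
    finally show "(x \<bullet> z) ^ m = zonal m x z - (\<Sum>i\<in>{1..m div 2}. ?e i * (x \<bullet> z) ^ (m - 2 * i))" by simp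
  qed (auto intro!: continuous_intros)
qed

lemma inner_power_expansion:
  assumes x: "norm x = 1" and z: "norm z = 1"
  shows "(x \<bullet> z) ^ n = (\<Sum>k\<le>n. measure (sphere_measure :: (real^'n) measure) UNIV * fh_coeff (real CARD('n)) n k *
    (\<Sum>j<N k. Y k j x * Y k j z))"
proof -
  have "(x \<bullet> z) ^ n = (\<Sum>k\<le>n. \<Sum>j<N k. (LINT y|sphere_measure. (x \<bullet> y) ^ n * Y k j y) * Y k j z)"
    using expands_inner_power[OF x, of n n] z by (auto simp: expands_def)
  also have "\<dots> = (\<Sum>k\<le>n. \<Sum>j<N k. measure (sphere_measure :: (real^'n) measure) UNIV *
      fh_coeff (real CARD('n)) n k * (Y k j x * Y k j z))"
    by (intro sum.cong refl) (simp add: funk_hecke_power[OF x d2 Y_harm])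
  finally show ?thesis by (simp add: sum_distrib_left)
qed

end

subsection \<open>Taylor coefficients of the Laplace kernel\<close>

text \<open>The first two values are the value and the derivative of exp (- c * sqrt (1 - t)) at 0.
  Both terms of the recursion have a positive sign, which gives positivity at once; without the term
  in \<open>c\<^sup>2\<close> it is the recursion of \<open>sqrt_coeff\<close>, which makes the two
  sequences comparable.\<close>

fun lap_coeff :: "real \<Rightarrow> nat \<Rightarrow> real" where
  "lap_coeff c 0 = exp (- c)"
| "lap_coeff c (Suc 0) = c / 2 * exp (- c)"
| "lap_coeff c (Suc (Suc n)) =
     ((real n + 1) * (real n + 1 / 2) * lap_coeff c (Suc n) + c\<^sup>2 / 4 * lap_coeff c n) /
       ((real n + 1) * (real n + 2))"

lemma lap_coeff_pos: "c > 0 \<Longrightarrow> lap_coeff c n > 0"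
proof (induction c n rule: lap_coeff.induct)
  case (3 c n)
  have "(real n + 1) * (real n + 1 / 2) * lap_coeff c (Suc n) > 0" "c\<^sup>2 / 4 * lap_coeff c n > 0"
    using 3 by (auto simp: zero_less_mult_iff add_nonneg_pos)
  then show ?case by (simp add: add_pos_pos)
qed auto

text \<open>\<open>sqrt_coeff n\<close> is minus the \<open>n\<close>-th Taylor coefficient of \<open>sqrt (1 - t)\<close>, for \<open>n \<ge> 1\<close>;
  the value at \<open>0\<close> is junk.\<close>

fun sqrt_coeff :: "nat \<Rightarrow> real" where
  "sqrt_coeff 0 = 0"
| "sqrt_coeff (Suc 0) = 1 / 2"
| "sqrt_coeff (Suc (Suc n)) = sqrt_coeff (Suc n) * (real n + 1 / 2) / (real n + 2)"

lemma sqrt_coeff_pos: "sqrt_coeff (Suc n) > 0"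
  by (induction n) auto

lemma sqrt_coeff_nonneg: "sqrt_coeff n \<ge> 0"
  by (cases n) (auto simp: less_imp_le[OF sqrt_coeff_pos])

text \<open>The sum telescopes since (2 n + 3) b(n+2) = 2 (n + 3) b(n+3) for b =
  \<open>sqrt_coeff\<close>. All partial sums are therefore at most 1, the value of 1 - sqrt (1 - t)
  at t = 1.\<close>

lemma sqrt_coeff_partial_sum: "(\<Sum>i<Suc (Suc n). sqrt_coeff i) = 1 - 2 * (real n + 2) * sqrt_coeff (Suc (Suc n))"
proof (induction n)
  case (Suc n)
  have "(\<Sum>i<Suc (Suc (Suc n)). sqrt_coeff i) = 1 - (2 * real n + 3) * sqrt_coeff (Suc (Suc n))"
    using Suc by (simp add: algebra_simps del: sqrt_coeff.simps(3))
  also have "(2 * real n + 3) * sqrt_coeff (Suc (Suc n)) = 2 * (real (Suc n) + 2) * sqrt_coeff (Suc (Suc (Suc n)))"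
    unfolding sqrt_coeff.simps(3)[of "Suc n"] by (simp add: field_simps del: sqrt_coeff.simps)
  finally show ?case .
qed (simp add: lessThan_Suc)

lemma summable_sqrt_coeff: "summable sqrt_coeff"
proof (rule summableI_nonneg_bounded[where x = 1])
  fix n
  have "(\<Sum>i<n. sqrt_coeff i) \<le> (\<Sum>i<Suc (Suc n). sqrt_coeff i)"
    by (rule sum_mono2) (auto simp: sqrt_coeff_nonneg)
  also have "\<dots> \<le> 1" unfolding sqrt_coeff_partial_sum
    using sqrt_coeff_nonneg[of "Suc (Suc n)"] by (simp del: sqrt_coeff.simps(3))
  finally show "(\<Sum>i<n. sqrt_coeff i) \<le> 1" .
qed (rule sqrt_coeff_nonneg)

text \<open>The quotient of \<open>lap_coeff c\<close> and \<open>sqrt_coeff\<close> increases, and its relative increment is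
  at most a constant times \<open>1 / ((n + 1 / 2) * (n + 3 / 2))\<close>, which telescopes.\<close>

lemma lap_coeff_comparable:
  assumes c: "c > 0"
  shows "\<exists>p q. p > 0 \<and> q > 0 \<and> (\<forall>n\<ge>1. p * sqrt_coeff n \<le> lap_coeff c n \<and> lap_coeff c n \<le> q * sqrt_coeff n)"
proof -
  define Q where "Q = (\<lambda>n. lap_coeff c (Suc n) / sqrt_coeff (Suc n))"
  define D where "D = (\<lambda>n::nat. c\<^sup>2 / 4 * (1 / (real n + 1 / 2)))"
  have Qp: "Q n > 0" for n using lap_coeff_pos[OF c] sqrt_coeff_pos by (simp add: Q_def)
  have step: "Q (Suc (Suc n)) = Q (Suc n) + (D n - D (Suc n)) * Q n" for n
  proof -
    let ?a = "lap_coeff c" and ?b = "sqrt_coeff (Suc n)"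
    have b: "?b > 0" by (rule sqrt_coeff_pos)
    have b2: "sqrt_coeff (Suc (Suc n)) = ?b * (real n + 1 / 2) / (real n + 2)"
      and b3: "sqrt_coeff (Suc (Suc (Suc n))) = ?b * (real n + 1 / 2) / (real n + 2) * (real n + 3 / 2) / (real n + 3)"
      by (simp_all add: add_ac)
    have a: "?a (Suc (Suc (Suc n))) = ((real n + 2) * (real n + 3 / 2) * ?a (Suc (Suc n)) + c\<^sup>2 / 4 * ?a (Suc n)) / ((real n + 2) * (real n + 3))"
      by (simp add: add_ac)
    define x where "x = real n"
    have x: "x \<ge> 0" "x + 1 / 2 > 0" "x + 2 > 0" "x + 3 / 2 > 0" "x + 3 > 0" by (auto simp: x_def)
    have D: "D n - D (Suc n) = c\<^sup>2 / 4 / ((x + 1 / 2) * (x + 3 / 2))"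
    proof -
      have "1 / (x + 1 / 2) - 1 / (x + 3 / 2) = 1 / ((x + 1 / 2) * (x + 3 / 2))"
        using x by (simp add: diff_frac_eq)
      moreover have "D n - D (Suc n) = c\<^sup>2 / 4 * (1 / (x + 1 / 2) - 1 / (x + 3 / 2))"
        by (simp add: D_def x_def right_diff_distrib add_ac)
      ultimately show ?thesis by simp
    qed
    have "Q (Suc (Suc n)) = ((x + 2) * (x + 3 / 2) * ?a (Suc (Suc n)) + c\<^sup>2 / 4 * ?a (Suc n)) / (?b * (x + 1 / 2) * (x + 3 / 2))"
      unfolding Q_def a b3 x_def[symmetric] using x b by (simp add: divide_simps del: lap_coeff.simps sqrt_coeff.simps)
        (simp add: algebra_simps del: lap_coeff.simps sqrt_coeff.simps)
    also have "\<dots> = ?a (Suc (Suc n)) / (?b * (x + 1 / 2) / (x + 2)) + (c\<^sup>2 / 4 / ((x + 1 / 2) * (x + 3 / 2))) * (?a (Suc n) / ?b)"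
      using x b by (simp add: divide_simps del: lap_coeff.simps sqrt_coeff.simps)
        (simp add: algebra_simps del: lap_coeff.simps sqrt_coeff.simps)
    finally show ?thesis unfolding D unfolding Q_def b2 x_def[symmetric] .
  qed
  have DD: "D n - D (Suc n) \<ge> 0" for n by (simp add: D_def field_simps)
  have mono: "Q (Suc n) \<le> Q (Suc (Suc n))" for n
    unfolding step using DD[of n] Qp[of n] by simp
  \<comment> \<open>The recursion for the quotient controls increments from index 1 on only, so
    \<open>Q 0\<close> enters \<open>p\<close>, \<open>m\<close> and \<open>q\<close>
    separately.\<close>
  define p where "p = min (Q 0) (Q 1)"
  have Q1: "Q 1 \<le> Q (Suc n)" for n by (induction n) (auto intro: order_trans[OF _ mono])
  have lo: "p \<le> Q n" for n using Q1 by (cases n) (auto simp: p_def min_le_iff_disj)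
  define m where "m = max 1 (Q 0 / Q 1)"
  have m: "m \<ge> 1" "Q n \<le> m * Q (Suc n)" for n
  proof -
    show "m \<ge> 1" by (simp add: m_def)
    show "Q n \<le> m * Q (Suc n)"
    proof (cases n)
      case 0
      have "Q 0 / Q 1 * Q 1 \<le> m * Q 1" using Qp[of 1] by (intro mult_right_mono) (auto simp: m_def)
      then show ?thesis using 0 Qp[of 1] by simp
    next
      case (Suc l)
      have "Q n \<le> 1 * Q (Suc n)" using mono[of l] Suc by simp
      also have "\<dots> \<le> m * Q (Suc n)" using Qp[of "Suc n"] by (intro mult_right_mono) (auto simp: m_def)
      finally show ?thesis .
    qed
  qed
  \<comment> \<open>A discrete Gronwall argument: \<open>m\<close> replaces \<open>Q n\<close> by
    the next quotient, each step then multiplies by at most 1 + m (D n - D (n+1)), and 1 + x <= exp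
    x lets the exponents telescope.\<close>
  have up: "Q (Suc n) \<le> Q 1 * exp (m * (D 0 - D n))" for n
  proof (induction n)
    case (Suc n)
    have "Q (Suc (Suc n)) \<le> Q (Suc n) + (D n - D (Suc n)) * (m * Q (Suc n))"
      unfolding step using DD[of n] m(2)[of n] by (intro add_left_mono mult_left_mono) auto
    also have "\<dots> = Q (Suc n) * (1 + m * (D n - D (Suc n)))" by (simp add: algebra_simps)
    also have "\<dots> \<le> (Q 1 * exp (m * (D 0 - D n))) * exp (m * (D n - D (Suc n)))"
      using Suc.IH Qp[of "Suc n"] DD[of n] m(1) Qp[of 1] by (intro mult_mono exp_ge_add_one_self) auto
    also have "\<dots> = Q 1 * exp (m * (D 0 - D (Suc n)))"
      by (simp add: mult.assoc exp_add[symmetric] algebra_simps)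
    finally show ?case .
  qed simp
  define q where "q = max (Q 0) (Q 1 * exp (m * D 0))"
  have hi: "Q n \<le> q" for n
  proof (cases n)
    case (Suc l)
    have "D l \<ge> 0" by (simp add: D_def)
    then have "exp (m * (D 0 - D l)) \<le> exp (m * D 0)" using m(1) by simp
    then have "Q 1 * exp (m * (D 0 - D l)) \<le> Q 1 * exp (m * D 0)" using Qp[of 1] by simp
    with up[of l] show ?thesis using Suc by (simp add: q_def)
  qed (simp add: q_def)
  have "p > 0" using Qp by (simp add: p_def)
  moreover have "q > 0" using Qp[of 0] by (simp add: q_def less_max_iff_disj)
  moreover have "p * sqrt_coeff n \<le> lap_coeff c n \<and> lap_coeff c n \<le> q * sqrt_coeff n" if n: "n \<ge> 1" for n
  proof -
    obtain l where l: "n = Suc l" using n by (cases n) auto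
    show ?thesis using lo[of l] hi[of l] sqrt_coeff_pos[of l] by (simp add: Q_def l field_simps)
  qed
  ultimately show ?thesis by blast
qed

lemma summable_lap_coeff:
  assumes c: "c > 0"
  shows "summable (lap_coeff c)"
proof -
  obtain q where q: "\<And>n. n \<ge> 1 \<Longrightarrow> lap_coeff c n \<le> q * sqrt_coeff n"
    using lap_coeff_comparable[OF c] by blast
  show ?thesis
  proof (rule summable_comparison_test')
    show "summable (\<lambda>n. q * sqrt_coeff n)" by (intro summable_mult summable_sqrt_coeff)
    show "norm (lap_coeff c n) \<le> q * sqrt_coeff n" if "n \<ge> 1" for n
      using q[OF that] lap_coeff_pos[OF c, of n] by simp
  qed
qed

text \<open>The recursion of \<open>lap_coeff\<close> says that the power series \<open>f\<close> solves
  \<open>(1 - t) f'' - f' / 2 = (c\<^sup>2 / 4) f\<close>. This operator factors, so first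
  \<open>sqrt (1 - t) f' = (c / 2) f\<close> and then \<open>f = exp (- c sqrt (1 - t))\<close>.\<close>

lemma lap_coeff_sums_interior:
  assumes c: "c > 0" and t: "\<bar>t\<bar> < 1"
  shows "(\<lambda>n. lap_coeff c n * t ^ n) sums exp (- c * sqrt (1 - t))"
proof -
  let ?a = "lap_coeff c"
  have sm0: "summable (\<lambda>n. ?a n * x ^ n)" if "\<bar>x\<bar> < 1" for x
    using powser_inside[of ?a 1 x] summable_lap_coeff[OF c] that by simp
  define f where "f = (\<lambda>x. \<Sum>n. ?a n * x ^ n)"
  define f1 where "f1 = (\<lambda>x. \<Sum>n. diffs ?a n * x ^ n)"
  define f2 where "f2 = (\<lambda>x. \<Sum>n. diffs (diffs ?a) n * x ^ n)"
  have sm1: "summable (\<lambda>n. diffs ?a n * x ^ n)" if "\<bar>x\<bar> < 1" for x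
    using termdiff_converges[of x 1 ?a] sm0 that by simp
  have sm2: "summable (\<lambda>n. diffs (diffs ?a) n * x ^ n)" if "\<bar>x\<bar> < 1" for x
    using termdiff_converges[of x 1 "diffs ?a"] sm1 that by simp
  have d0: "(f has_real_derivative f1 x) (at x)" if "\<bar>x\<bar> < 1" for x
    unfolding f_def f1_def using termdiffs_strong'[of 1 ?a x] sm0 that by simp
  have d1: "(f1 has_real_derivative f2 x) (at x)" if "\<bar>x\<bar> < 1" for x
    unfolding f1_def f2_def using termdiffs_strong'[of 1 "diffs ?a" x] sm1 that by simp
  have ode: "(1 - x) * f2 x - f1 x / 2 = c\<^sup>2 / 4 * f x" if x: "\<bar>x\<bar> < 1" for x
  proof -
    have co: "diffs (diffs ?a) n = (real n + 1 / 2) * diffs ?a n + c\<^sup>2 / 4 * ?a n" for n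
    proof -
      have "(real n + 1) * (real n + 2) * ?a (Suc (Suc n)) = (real n + 1) * (real n + 1 / 2) * ?a (Suc n) + c\<^sup>2 / 4 * ?a n"
        using of_nat_0_le_iff[of n] by (simp add: add_nonneg_eq_0_iff)
      then show ?thesis by (simp add: diffs_def algebra_simps add_divide_distrib del: lap_coeff.simps)
    qed
    have "(\<lambda>n. diffs ?a n * x ^ n) sums f1 x" "(\<lambda>n. ?a n * x ^ n) sums f x" "(\<lambda>n. diffs (diffs ?a) n * x ^ n) sums f2 x"
      using sm0[OF x] sm1[OF x] sm2[OF x] by (auto simp: f_def f1_def f2_def summable_sums)
    note s = this
    have "(\<lambda>n. (diffs (diffs ?a) n * x ^ n) * x) sums (f2 x * x)" using s(3) by (rule sums_mult2)
    \<comment> \<open>Multiplication by x shifts the coefficients of the second derivative: the one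
      of x^n is n times that of the first derivative, and it is 0 for n = 0.\<close>
    then have "(\<lambda>n. real n * diffs ?a n * x ^ n) sums (f2 x * x)"
      by (subst sums_Suc_iff[symmetric, where f = "\<lambda>n. real n * diffs ?a n * x ^ n" and s = "f2 x * x", simplified])
         (simp add: diffs_def mult_ac del: lap_coeff.simps)
    from sums_add[OF sums_add[OF this sums_mult[OF s(1), of "1/2"]] sums_mult[OF s(2), of "c\<^sup>2/4"]]
    have "(\<lambda>n. diffs (diffs ?a) n * x ^ n) sums (f2 x * x + 1 / 2 * f1 x + c\<^sup>2 / 4 * f x)"
      unfolding co by (simp add: algebra_simps)
    with s(3) have "f2 x = f2 x * x + 1 / 2 * f1 x + c\<^sup>2 / 4 * f x" by (rule sums_unique2)
    then show ?thesis by (simp add: algebra_simps)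
  qed
  have const: "h x = h 0" if "\<And>x. \<bar>x\<bar> < 1 \<Longrightarrow> (h has_real_derivative 0) (at x)" "\<bar>x\<bar> < 1" for h :: "real \<Rightarrow> real" and x
  proof -
    have "\<exists>k. \<forall>x\<in>{-1<..<1}. h x = k"
    proof (rule has_field_derivative_zero_constant)
      fix y :: real assume "y \<in> {-1<..<1}"
      then have "\<bar>y\<bar> < 1" by (simp add: abs_less_iff)
      from that(1)[OF this] show "(h has_field_derivative 0) (at y within {-1<..<1})"
        by (rule has_field_derivative_at_within)
    qed simp
    then obtain k where "\<And>y. y \<in> {-1<..<1} \<Longrightarrow> h y = k" by blast
    from this[of x] this[of 0] that(2) show ?thesis by (simp add: abs_less_iff)
  qed
  have f0: "f 0 = exp (- c)" "f1 0 = c / 2 * exp (- c)"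
    unfolding f_def f1_def by (simp_all add: diffs_def)
  have dsq: "((\<lambda>x. sqrt (1 - x)) has_real_derivative - 1 / (2 * sqrt (1 - x))) (at x)" if "\<bar>x\<bar> < 1" for x
    using that by (auto intro!: derivative_eq_intros simp: field_simps)
  \<comment> \<open>The equation amounts to g' = - c g / (2 sqrt (1 - x)), so g times exp (- c sqrt
    (1 - x)) is constant. The initial values give g 0 = 0, which excludes the second solution exp (c
    sqrt (1 - x)).\<close>
  define g where "g = (\<lambda>x. sqrt (1 - x) * f1 x - c / 2 * f x)"
  have "g x * exp (- c * sqrt (1 - x)) = g 0 * exp (- c * sqrt (1 - 0))" if "\<bar>x\<bar> < 1" for x
  proof (rule const[OF _ that])
    fix x :: real assume x: "\<bar>x\<bar> < 1"
    define s where "s = sqrt (1 - x)"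
    have s: "s > 0" "s\<^sup>2 = 1 - x" using x by (auto simp: s_def)
    have "((\<lambda>x. g x * exp (- c * sqrt (1 - x))) has_real_derivative
        ((- 1 / (2 * s) * f1 x + s * f2 x) - c / 2 * f1 x) * exp (- c * s) +
        g x * (exp (- c * s) * (- c * (- 1 / (2 * s))))) (at x)"
      unfolding g_def
      by (rule DERIV_cong[OF DERIV_mult[OF DERIV_diff[OF DERIV_mult[OF dsq[OF x] d1[OF x]] DERIV_cmult[OF d0[OF x]]]
            DERIV_fun_exp[OF DERIV_cmult[OF dsq[OF x]]]]]) (simp add: s_def mult_ac)
    moreover have "((- 1 / (2 * s) * f1 x + s * f2 x) - c / 2 * f1 x) * exp (- c * s) +
        g x * (exp (- c * s) * (- c * (- 1 / (2 * s)))) = 0"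
    proof -
      have "((- 1 / (2 * s) * f1 x + s * f2 x) - c / 2 * f1 x) + g x * (c / (2 * s)) =
        (s\<^sup>2 * f2 x - f1 x / 2 - c\<^sup>2 / 4 * f x) / s"
        unfolding g_def s_def[symmetric] using s(1) by (simp add: field_simps power2_eq_square)
      also have "\<dots> = 0" unfolding s(2) using ode[OF x] by simp
      finally have "(((- 1 / (2 * s) * f1 x + s * f2 x) - c / 2 * f1 x) + g x * (c / (2 * s))) * exp (- c * s) = 0" by simp
      then show ?thesis by (simp add: algebra_simps)
    qed
    ultimately show "((\<lambda>x. g x * exp (- c * sqrt (1 - x))) has_real_derivative 0) (at x)" by simp
  qed
  moreover have "g 0 = 0" by (simp add: g_def f0)
  ultimately have g0: "g x = 0" if "\<bar>x\<bar> < 1" for x using that by simp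
  have "f t * exp (c * sqrt (1 - t)) = f 0 * exp (c * sqrt (1 - 0))"
  proof (rule const[OF _ t])
    fix x :: real assume x: "\<bar>x\<bar> < 1"
    define s where "s = sqrt (1 - x)"
    have s: "s > 0" using x by (auto simp: s_def)
    have "((\<lambda>x. f x * exp (c * sqrt (1 - x))) has_real_derivative
        f1 x * exp (c * s) + f x * (exp (c * s) * (c * (- 1 / (2 * s))))) (at x)"
      by (rule DERIV_cong[OF DERIV_mult[OF d0[OF x] DERIV_fun_exp[OF DERIV_cmult[OF dsq[OF x]]]]])
        (simp add: s_def mult_ac)
    moreover have "f1 x = c / 2 * f x / s"
      using g0[OF x] s by (simp add: g_def s_def[symmetric] field_simps)
    ultimately show "((\<lambda>x. f x * exp (c * sqrt (1 - x))) has_real_derivative 0) (at x)" by simp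
  qed
  also have "\<dots> = 1" by (simp add: f0 exp_add[symmetric])
  finally have "f t = exp (- c * sqrt (1 - t))" by (simp add: exp_minus field_simps)
  then show ?thesis using sm0[OF t] unfolding f_def by (metis summable_sums)
qed

text \<open>The endpoints are needed because \<open>x \<bullet> z\<close> reaches 1 and -1 on the
  sphere. The differential equation degenerates at t = 1, but both sides are continuous on the
  closed interval, the series by the Weierstrass test.\<close>

lemma lap_coeff_sums:
  assumes c: "c > 0" and t: "\<bar>t\<bar> \<le> 1"
  shows "(\<lambda>n. lap_coeff c n * t ^ n) sums exp (- c * sqrt (1 - t))"
proof -
  let ?a = "lap_coeff c"
  have b: "norm (?a n * x ^ n) \<le> ?a n" if "x \<in> {-1..1}" for n x
  proof -
    have "?a n * \<bar>x\<bar> ^ n \<le> ?a n * 1"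
      using that less_imp_le[OF lap_coeff_pos[OF c, of n]] by (intro mult_left_mono power_le_one) auto
    then show ?thesis using lap_coeff_pos[OF c, of n] by (simp add: abs_mult power_abs)
  qed
  have u: "uniform_limit {-1..1} (\<lambda>n x. \<Sum>i<n. ?a i * x ^ i) (\<lambda>x. \<Sum>i. ?a i * x ^ i) sequentially"
    by (rule Weierstrass_m_test[OF b summable_lap_coeff[OF c]])
  have "continuous_on {-1..1} (\<lambda>x. \<Sum>i. ?a i * x ^ i)"
    by (rule uniform_limit_theorem[OF _ u]) (auto intro!: always_eventually continuous_intros)
  moreover have "continuous_on {-1..1} (\<lambda>x. exp (- c * sqrt (1 - x)))" by (intro continuous_intros)
  ultimately have cd: "continuous_on {-1..1} (\<lambda>x. (\<Sum>i. ?a i * x ^ i) - exp (- c * sqrt (1 - x)))"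
    by (rule continuous_on_diff)
  have "(\<Sum>i. ?a i * t ^ i) - exp (- c * sqrt (1 - t)) = 0"
    by (rule continuous_constant_on_closure[where S = "{-1<..<1::real}" and a = 0 and x = t])
       (use cd t lap_coeff_sums_interior[OF c] in \<open>auto simp: sums_iff\<close>)
  moreover have "summable (\<lambda>n. ?a n * t ^ n)"
    by (rule summable_comparison_test'[OF summable_lap_coeff[OF c], of 0]) (use b[of t] t in \<open>auto simp: abs_le_iff\<close>)
  ultimately show ?thesis by (simp add: sums_iff)
qed

subsection \<open>Eigenvalues\<close>

text \<open>With a positive limit, T would eventually dominate a multiple of the harmonic series.
  This disposes of the boundary term of the telescoping sum below.\<close>

lemma tendsto_of_nat_mult_eq_0:
  fixes T :: "nat \<Rightarrow> real"
  assumes "summable T" "\<And>n. T n \<ge> 0" and lim: "(\<lambda>n. real n * T n) \<longlonglongrightarrow> L"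
  shows "L = 0"
proof (rule ccontr)
  assume "L \<noteq> 0"
  moreover have "L \<ge> 0" by (rule LIMSEQ_le_const[OF lim]) (use assms(2) in auto)
  ultimately have "L > 0" by simp
  then have "\<forall>\<^sub>F n in sequentially. real n * T n > L / 2"
    by (intro order_tendstoD(1)[OF lim]) simp
  then have "\<forall>\<^sub>F n in sequentially. norm (inverse (real n)) \<le> 2 / L * T n"
    using eventually_gt_at_top[of 0]
    by eventually_elim (use \<open>L > 0\<close> in \<open>auto simp: field_simps\<close>)
  from summable_comparison_test_ev[OF this summable_mult[OF assms(1)]]
  show False using not_summable_harmonic[where 'a = real] by simp
qed

section \<open>Eigenvalue sums for the square root\<close>

lemma sqrt_coeff_Suc: "n \<ge> 1 \<Longrightarrow> sqrt_coeff (Suc n) = sqrt_coeff n * (real n - 1 / 2) / (real n + 1)"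
  by (cases n) (auto simp: add_ac)

definition sqrt_eigen :: "real \<Rightarrow> nat \<Rightarrow> real" where
  "sqrt_eigen d k = (\<Sum>n. sqrt_coeff n * fh_coeff d n k)"

lemma summable_sqrt_eigen: "d \<ge> 1 \<Longrightarrow> summable (\<lambda>n. sqrt_coeff n * fh_coeff d n k)"
  by (rule summable_comparison_test'[OF summable_sqrt_coeff, of 0])
    (auto simp: abs_mult sqrt_coeff_nonneg fh_coeff_nonneg fh_coeff_le_1 mult_left_le)

text \<open>A Wilf--Zeilberger pair: \<open>T' j\<close> and \<open>T j\<close> are the summands of \<open>sqrt_eigen d (k + 1)\<close> and
  \<open>sqrt_eigen d k\<close>, and the certificate is \<open>- 2 * j\<close>.\<close>

lemma sqrt_eigen_rec:
  assumes d: "d \<ge> 1" and k: "k \<ge> 1"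
  shows "(real k + d - 1 / 2) * sqrt_eigen d (Suc k) = (real k - 1 / 2) * sqrt_eigen d k"
proof -
  define T where "T = (\<lambda>j. sqrt_coeff (k + 2 * j) * fh_coeff d (k + 2 * j) k)"
  define T' where "T' = (\<lambda>j. sqrt_coeff (Suc k + 2 * j) * fh_coeff d (Suc k + 2 * j) (Suc k))"
  have re: "summable (\<lambda>j. sqrt_coeff (k + 2 * j) * fh_coeff d (k + 2 * j) k)"
     "sqrt_eigen d k = (\<Sum>j. sqrt_coeff (k + 2 * j) * fh_coeff d (k + 2 * j) k)" for k
  proof -
    have m: "strict_mono (\<lambda>j. k + 2 * j)" by (simp add: strict_mono_def)
    have z: "sqrt_coeff n * fh_coeff d n k = 0" if "n \<notin> range (\<lambda>j. k + 2 * j)" for n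
      using that fh_coeff_eq_0[of n k d] by auto
    show "summable (\<lambda>j. sqrt_coeff (k + 2 * j) * fh_coeff d (k + 2 * j) k)"
      using summable_mono_reindex[of _ "\<lambda>n. sqrt_coeff n * fh_coeff d n k", OF m z] summable_sqrt_eigen[OF d] by simp
    show "sqrt_eigen d k = (\<Sum>j. sqrt_coeff (k + 2 * j) * fh_coeff d (k + 2 * j) k)"
      unfolding sqrt_eigen_def using suminf_mono_reindex[of _ "\<lambda>n. sqrt_coeff n * fh_coeff d n k", OF m z] by simp
  qed
  have wz: "(real k + d - 1 / 2) * T' j - (real k - 1 / 2) * T j = 2 * real j * T j - 2 * real (Suc j) * T (Suc j)" for j
  proof -
    define n where "n = k + 2 * j"
    \<comment> \<open>Here \<open>k \<ge> 1\<close> keeps the recursion of \<open>sqrt_coeff\<close>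
      away from its junk value at 0.\<close>
    have n: "n \<ge> 1" using k by (simp add: n_def)
    define E where "E = d / 2 + real (k + j)"
    have E: "E > 0" using d by (simp add: E_def add_pos_nonneg)
    define M where "M = fh_coeff d n k"
    define P where "P = pochhammer (d / 2) (k + j)"
    have P: "P > 0" using d by (simp add: P_def pochhammer_pos)
    have M: "M = fact n / (2 ^ n * fact j * P)"
      unfolding M_def n_def P_def by (rule fh_coeff_even)
    have M1: "fh_coeff d (Suc n) (Suc k) = M * (real n + 1) / (2 * E)"
    proof -
      have "fh_coeff d (Suc n) (Suc k) = fact (Suc n) / (2 ^ Suc n * fact j * pochhammer (d / 2) (Suc (k + j)))"
        using fh_coeff_even[of d "Suc k" j] by (simp add: n_def)
      also have "\<dots> = ((real n + 1) * fact n) / (2 * 2 ^ n * fact j * (P * E))"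
        by (simp add: pochhammer_Suc P_def E_def add_ac)
      finally show ?thesis unfolding M by (simp add: mult_ac)
    qed
    have M2: "fh_coeff d (Suc (Suc n)) k = M * ((real n + 1) * (real n + 2)) / (4 * real (Suc j) * E)"
    proof -
      have "fh_coeff d (Suc (Suc n)) k = fact (Suc (Suc n)) / (2 ^ Suc (Suc n) * fact (Suc j) * pochhammer (d / 2) (Suc (k + j)))"
        using fh_coeff_even[of d k "Suc j"] by (simp add: n_def)
      also have "\<dots> = ((real n + 2) * ((real n + 1) * fact n)) / (4 * 2 ^ n * (real (Suc j) * fact j) * (P * E))"
        by (simp add: pochhammer_Suc P_def E_def add_ac)
      finally show ?thesis unfolding M by (simp add: mult_ac)
    qed
    define b where "b = sqrt_coeff n"
    have b1: "sqrt_coeff (Suc n) = b * (real n - 1 / 2) / (real n + 1)"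
      using sqrt_coeff_Suc[OF n] by (simp add: b_def)
    have b2: "sqrt_coeff (Suc (Suc n)) = b * (real n - 1 / 2) / (real n + 1) * (real n + 1 / 2) / (real n + 2)"
      using sqrt_coeff_Suc[of "Suc n"] b1 by (simp add: add_ac del: sqrt_coeff.simps)
    have t0: "T j = b * M" by (simp add: T_def n_def[symmetric] b_def M_def)
    have n12: "real n + 1 > 0" "real n + 2 > 0" by auto
    have "T' j = b * (real n - 1 / 2) / (real n + 1) * (M * (real n + 1) / (2 * E))"
      unfolding T'_def using b1 M1 by (simp add: n_def del: sqrt_coeff.simps)
    then have t1: "T' j = b * M * (real n - 1 / 2) / (2 * E)" using n12 by simp
    have "T (Suc j) = (b * (real n - 1 / 2) / (real n + 1) * (real n + 1 / 2) / (real n + 2)) *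
        (M * ((real n + 1) * (real n + 2)) / (4 * real (Suc j) * E))"
      unfolding T_def using b2 M2 by (simp add: n_def del: sqrt_coeff.simps)
    also have "\<dots> = b * M * (real n - 1 / 2) * (real n + 1 / 2) / (4 * real (Suc j) * E)"
      using n12 by simp
    finally have t2: "2 * real (Suc j) * T (Suc j) = b * M * (real n - 1 / 2) * (real n + 1 / 2) / (2 * E)"
      by (simp del: of_nat_Suc)
    \<comment> \<open>Both sides equal (n - 1/2) (n + k + d), since 2 E = n + k + d and 2 j + k =
      n.\<close>
    have "(real k + d - 1 / 2) * (real n - 1 / 2) + (real n - 1 / 2) * (real n + 1 / 2) =
        (2 * real j + real k - 1 / 2) * (2 * E)"
      by (simp add: n_def E_def algebra_simps)
    then have "((real k + d - 1 / 2) * (real n - 1 / 2) + (real n - 1 / 2) * (real n + 1 / 2)) / (2 * E)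
       = 2 * real j + real k - 1 / 2" using E by simp
    then have "b * M * (((real k + d - 1 / 2) * (real n - 1 / 2) + (real n - 1 / 2) * (real n + 1 / 2)) / (2 * E))
       = b * M * (2 * real j + real k - 1 / 2)" by simp
    then have "(real k + d - 1 / 2) * (b * M * (real n - 1 / 2) / (2 * E)) + b * M * (real n - 1 / 2) * (real n + 1 / 2) / (2 * E)
       = b * M * (2 * real j + real k - 1 / 2)"
      by (simp only: add_divide_distrib distrib_left) (simp add: mult_ac)
    then show ?thesis unfolding t0 t1 t2 by (simp add: algebra_simps)
  qed
  have sm: "summable T" "summable T'" using re(1)[of k] re(1)[of "Suc k"] by (simp_all add: T_def T'_def)
  have sums: "sqrt_eigen d k = suminf T" "sqrt_eigen d (Suc k) = suminf T'"
    unfolding T_def T'_def by (rule re(2))+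
  let ?L = "(real k + d - 1 / 2) * suminf T' - (real k - 1 / 2) * suminf T"
  \<comment> \<open>The certificate term vanishes at j = 0, so only the one at J remains. It
    converges because the series on the left does, and summability of \<open>T\<close> forces its
    limit to be 0.\<close>
  have part: "(\<Sum>j<J. (real k + d - 1 / 2) * T' j - (real k - 1 / 2) * T j) = - 2 * (real J * T J)" for J
    unfolding wz by (induction J) (simp_all add: algebra_simps)
  have "(\<lambda>j. (real k + d - 1 / 2) * T' j - (real k - 1 / 2) * T j) sums ?L"
    by (intro sums_diff sums_mult summable_sums sm)
  then have "(\<lambda>J. - 2 * (real J * T J)) \<longlonglongrightarrow> ?L" unfolding sums_def part .
  then have "(\<lambda>J. (- 1 / 2) * (- 2 * (real J * T J))) \<longlonglongrightarrow> (- 1 / 2) * ?L" by (intro tendsto_mult tendsto_const)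
  then have "(\<lambda>J. real J * T J) \<longlonglongrightarrow> (- 1 / 2) * ?L" by simp
  moreover have "T j \<ge> 0" for j
    using d by (simp add: T_def sqrt_coeff_nonneg fh_coeff_nonneg)
  ultimately have "(- 1 / 2) * ?L = 0" by (intro tendsto_of_nat_mult_eq_0[OF sm(1)])
  then show ?thesis unfolding sums by simp
qed

text \<open>Passing from z to z + 1 multiplies \<open>pochhammer z d\<close> by (z + d) / z, the
  inverse of the factor in \<open>sqrt_eigen_rec\<close>; the product is therefore independent of
  k.\<close>

lemma sqrt_eigen_eq:
  assumes d: "d \<ge> 1"
  shows "sqrt_eigen (real d) (Suc k) * pochhammer (real k + 1 / 2) d = sqrt_eigen (real d) 1 * pochhammer (1 / 2) d"
proof (induction k)
  case (Suc k)
  let ?z = "real k + 1 / 2" and ?u = "sqrt_eigen (real d)"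
  have "(?z + real d) * ?u (Suc (Suc k)) = ?z * ?u (Suc k)"
    using sqrt_eigen_rec[of "real d" "Suc k"] d by (simp add: algebra_simps)
  moreover have "?z * pochhammer (?z + 1) d = (?z + real d) * pochhammer ?z d"
    using pochhammer_rec[of ?z d] pochhammer_rec'[of ?z d] by simp
  ultimately have "?z * (?u (Suc (Suc k)) * pochhammer (?z + 1) d) = ?z * (?u (Suc k) * pochhammer ?z d)"
    by algebra
  then have "?u (Suc (Suc k)) * pochhammer (?z + 1) d = ?u (Suc k) * pochhammer ?z d" by simp
  then show ?case using Suc by (simp add: add_ac)
qed simp

text \<open>Each of the d Pochhammer factors k - 1/2 + i lies between k / 2 and (d + 1) k.\<close>

lemma sqrt_eigen_asymp:
  assumes d: "d \<ge> 1"
  shows "\<exists>B1 B2. B1 > 0 \<and> B2 > 0 \<and> (\<forall>k\<ge>1. B1 / real k ^ d \<le> sqrt_eigen (real d) k \<and> sqrt_eigen (real d) k \<le> B2 / real k ^ d)"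
proof -
  define C where "C = sqrt_eigen (real d) 1 * pochhammer (1 / 2) d"
  have "0 < sqrt_coeff 1 * fh_coeff (real d) 1 1" using d by (simp add: fh_coeff_pos)
  also have "\<dots> \<le> sqrt_eigen (real d) 1"
    unfolding sqrt_eigen_def
    using sum_le_suminf[OF summable_sqrt_eigen[of "real d" 1], of "{1}"] d
    by (simp add: sqrt_coeff_nonneg fh_coeff_nonneg)
  finally have C: "C > 0" by (simp add: C_def pochhammer_pos)
  have "C / (real d + 1) ^ d / real k ^ d \<le> sqrt_eigen (real d) k \<and> sqrt_eigen (real d) k \<le> C * 2 ^ d / real k ^ d"
    if k: "k \<ge> 1" for k
  proof -
    obtain l where l: "k = Suc l" using k by (cases k) auto
    define P where "P = pochhammer (real l + 1 / 2) d"
    have P: "P > 0" unfolding P_def by (rule pochhammer_pos) simp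
    have u: "sqrt_eigen (real d) k = C / P" using sqrt_eigen_eq[OF d, of l] P
      by (simp add: C_def P_def l field_simps)
    have "(\<Prod>i<d. real k / 2) \<le> (\<Prod>i<d. real l + 1 / 2 + real i)"
      by (rule prod_mono) (auto simp: l)
    then have lo: "(real k / 2) ^ d \<le> P" by (simp add: P_def pochhammer_prod atLeast0LessThan)
    have "(\<Prod>i<d. real l + 1 / 2 + real i) \<le> (\<Prod>i<d. (real d + 1) * real k)"
    proof (rule prod_mono, rule conjI)
      fix i assume "i \<in> {..<d}"
      then have "real i \<le> real d * 1" by simp
      also have "\<dots> \<le> real d * real k" using k by (intro mult_left_mono) auto
      finally show "real l + 1 / 2 + real i \<le> (real d + 1) * real k" by (simp add: l algebra_simps)
      show "0 \<le> real l + 1 / 2 + real i" by simp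
    qed
    then have hi: "P \<le> ((real d + 1) * real k) ^ d" by (simp add: P_def pochhammer_prod atLeast0LessThan)
    have "C / P \<le> C / (real k / 2) ^ d" using lo C P k by (intro divide_left_mono) auto
    moreover have "C / ((real d + 1) * real k) ^ d \<le> C / P" using hi C P k by (intro divide_left_mono) auto
    ultimately show ?thesis unfolding u by (simp add: power_mult_distrib power_divide)
  qed
  moreover have "C / (real d + 1) ^ d > 0" "C * 2 ^ d > 0" using C by auto
  ultimately show ?thesis by blast
qed

section \<open>Eigenvalues of the Laplace kernel\<close>

definition lap_eigen :: "real \<Rightarrow> real \<Rightarrow> nat \<Rightarrow> real" where
  "lap_eigen c d k = (\<Sum>n. lap_coeff c n * fh_coeff d n k)"

lemma summable_lap_eigen:
  assumes "c > 0" "d \<ge> 1"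
  shows "summable (\<lambda>n. lap_coeff c n * fh_coeff d n k)"
  by (rule summable_comparison_test'[OF summable_lap_coeff[OF assms(1)], of 0])
    (use assms in \<open>auto simp: abs_mult less_imp_le[OF lap_coeff_pos] fh_coeff_nonneg fh_coeff_le_1 mult_left_le\<close>)

text \<open>All terms are nonnegative and the term n = k is positive.\<close>

lemma lap_eigen_pos:
  assumes "c > 0" "d \<ge> 1"
  shows "lap_eigen c d k > 0"
proof -
  have "0 < lap_coeff c k * fh_coeff d k k" using assms by (simp add: lap_coeff_pos fh_coeff_pos)
  also have "\<dots> \<le> lap_eigen c d k"
    unfolding lap_eigen_def
    using sum_le_suminf[OF summable_lap_eigen[OF assms, of k], of "{k}"] assms
    by (simp add: less_imp_le[OF lap_coeff_pos] fh_coeff_nonneg)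
  finally show ?thesis .
qed

lemma lap_eigen_asymp:
  assumes c: "c > 0" and d: "d \<ge> 1"
  shows "\<exists>B1 B2. B1 > 0 \<and> B2 > 0 \<and> (\<forall>k\<ge>1. B1 / real k ^ d \<le> lap_eigen c (real d) k \<and> lap_eigen c (real d) k \<le> B2 / real k ^ d)"
proof -
  obtain p q where pq: "p > 0" "q > 0" and cmp: "\<And>n. n \<ge> 1 \<Longrightarrow> p * sqrt_coeff n \<le> lap_coeff c n"
      "\<And>n. n \<ge> 1 \<Longrightarrow> lap_coeff c n \<le> q * sqrt_coeff n"
    using lap_coeff_comparable[OF c] by blast
  obtain B1 B2 where B: "B1 > 0" "B2 > 0"
    "\<And>k. k \<ge> 1 \<Longrightarrow> B1 / real k ^ d \<le> sqrt_eigen (real d) k" "\<And>k. k \<ge> 1 \<Longrightarrow> sqrt_eigen (real d) k \<le> B2 / real k ^ d"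
    using sqrt_eigen_asymp[OF d] by blast
  have "p * B1 / real k ^ d \<le> lap_eigen c (real d) k \<and> lap_eigen c (real d) k \<le> q * B2 / real k ^ d" if k: "k \<ge> 1" for k
  proof
    have d1: "real d \<ge> 1" using d by simp
    note s1 = summable_sqrt_eigen[OF d1, of k] and s2 = summable_lap_eigen[OF c d1, of k]
    have le: "p * (sqrt_coeff n * fh_coeff (real d) n k) \<le> lap_coeff c n * fh_coeff (real d) n k"
      "lap_coeff c n * fh_coeff (real d) n k \<le> q * (sqrt_coeff n * fh_coeff (real d) n k)" for n
    proof -
      have f: "fh_coeff (real d) n k \<ge> 0" using d by (simp add: fh_coeff_nonneg)
      \<comment> \<open>The coefficient comparison starts at n = 1; the constant term does not
        matter because its Funk-Hecke coefficient vanishes for \<open>k \<ge> 1\<close>.\<close>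
      have z: "fh_coeff (real d) n k = 0" if "n = 0" using that k by (simp add: fh_coeff_0)
      show "p * (sqrt_coeff n * fh_coeff (real d) n k) \<le> lap_coeff c n * fh_coeff (real d) n k"
        using z mult_right_mono[OF cmp(1) f] by (cases "n = 0") (auto simp: mult.assoc)
      show "lap_coeff c n * fh_coeff (real d) n k \<le> q * (sqrt_coeff n * fh_coeff (real d) n k)"
        using z mult_right_mono[OF cmp(2) f] by (cases "n = 0") (auto simp: mult.assoc)
    qed
    have "p * (B1 / real k ^ d) \<le> p * sqrt_eigen (real d) k" using B(3)[OF k] pq by (intro mult_left_mono) auto
    also have "\<dots> = (\<Sum>n. p * (sqrt_coeff n * fh_coeff (real d) n k))" unfolding sqrt_eigen_def by (rule suminf_mult[OF s1, symmetric])
    also have "\<dots> \<le> lap_eigen c (real d) k"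
      unfolding lap_eigen_def by (intro suminf_le le summable_mult s1 s2)
    finally show "p * B1 / real k ^ d \<le> lap_eigen c (real d) k" by simp
    have "lap_eigen c (real d) k \<le> (\<Sum>n. q * (sqrt_coeff n * fh_coeff (real d) n k))"
      unfolding lap_eigen_def by (intro suminf_le le summable_mult s1 s2)
    also have "\<dots> = q * sqrt_eigen (real d) k" unfolding sqrt_eigen_def by (rule suminf_mult[OF s1])
    also have "\<dots> \<le> q * (B2 / real k ^ d)" using B(4)[OF k] pq by (intro mult_left_mono) auto
    finally show "lap_eigen c (real d) k \<le> q * B2 / real k ^ d" by simp
  qed
  then show ?thesis using pq B by (intro exI[of _ "p * B1"] exI[of _ "q * B2"]) auto
qed

lemma abs_inner_le_1: "norm x = 1 \<Longrightarrow> norm z = 1 \<Longrightarrow> \<bar>x \<bullet> z\<bar> \<le> 1"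
  using Cauchy_Schwarz_ineq2[of x z] by simp

lemma lap_kernel_sums:
  assumes "c > 0" "norm x = 1" "norm z = 1"
  shows "(\<lambda>n. lap_coeff c n * (x \<bullet> z) ^ n) sums lap_kernel c x z"
  unfolding lap_kernel_def by (intro lap_coeff_sums abs_inner_le_1 assms)

text \<open>Expand the kernel in powers and integrate term by term; summability of
  \<open>lap_coeff\<close> together with a bound for Y on the sphere justifies this, and the
  Funk-Hecke formula evaluates every term.\<close>

lemma mercer_eigenvalue_lap_kernel:
  assumes c: "c > 0" and d2: "CARD('n::finite) \<ge> 2"
  shows "mercer_eigenvalue (lap_kernel c :: real^'n \<Rightarrow> real^'n \<Rightarrow> real) k
    (measure (sphere_measure :: (real^'n) measure) UNIV * lap_eigen c (real CARD('n)) k)"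
  unfolding mercer_eigenvalue_def
proof (intro ballI)
  fix Y :: "real^'n \<Rightarrow> real" and x :: "real^'n"
  assume Y: "Y \<in> sph_harm k" and "x \<in> sphere 0 1"
  then have x: "norm x = 1" by simp
  let ?S = "measure (sphere_measure :: (real^'n) measure) UNIV" and ?d = "real CARD('n)"
  have d1: "?d \<ge> 1" using d2 by simp
  have Yc: "continuous_on A Y" for A using Y hpoly_continuous sph_harm_iff by blast
  have "compact (Y ` sphere 0 1)" by (rule compact_continuous_image[OF Yc]) auto
  then obtain M where M: "\<And>z. z \<in> sphere 0 1 \<Longrightarrow> norm (Y z) \<le> M"
    using compact_imp_bounded bounded_iff by (metis imageI)
  define f where "f = (\<lambda>n z. lap_coeff c n * ((x \<bullet> z) ^ n * Y z))"
  have fc: "continuous_on UNIV (f n)" for n unfolding f_def by (intro continuous_intros Yc)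
  have fm[measurable]: "f n \<in> borel_measurable borel" for n by (rule borel_measurable_continuous_onI[OF fc])
  have fb: "norm (f n z) \<le> lap_coeff c n * M" if "z \<in> sphere 0 1" for n z
  proof -
    have "\<bar>x \<bullet> z\<bar> ^ n * \<bar>Y z\<bar> \<le> 1 * M"
      using abs_inner_le_1[OF x, of z] M[OF that] that by (intro mult_mono power_le_one) auto
    then show ?thesis using lap_coeff_pos[OF c, of n] by (simp add: f_def abs_mult power_abs mult_left_mono)
  qed
  have sums: "(\<lambda>n. LINT z|sphere_measure. f n z) sums (LINT z|sphere_measure. (\<Sum>n. f n z))"
  proof (rule sums_integral)
    show "integrable sphere_measure (f n)" for n by (rule integrable_sphere_measure[OF fc])
    show "AE z in sphere_measure. summable (\<lambda>n. norm (f n z))"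
      using AE_sphere_measure
    proof eventually_elim
      case (elim z)
      show ?case
        by (rule summable_comparison_test'[OF summable_mult2[OF summable_lap_coeff[OF c], of M], of 0])
          (use fb[OF elim] in simp)
    qed
    have bd: "norm (LINT z|sphere_measure. norm (f n z)) \<le> lap_coeff c n * (M * ?S)" for n
    proof -
      have "(LINT z|sphere_measure. norm (f n z)) \<le> (\<integral>z. lap_coeff c n * M \<partial>(sphere_measure :: (real^'n) measure))"
      proof (rule integral_mono_AE)
        show "integrable sphere_measure (\<lambda>z. norm (f n z))"
          by (intro integrable_norm integrable_sphere_measure fc)
        show "integrable (sphere_measure :: (real^'n) measure) (\<lambda>z. lap_coeff c n * M)"
          by (intro integrable_sphere_measure continuous_intros)
        show "AE z in sphere_measure. norm (f n z) \<le> lap_coeff c n * M"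
          using AE_sphere_measure by eventually_elim (rule fb)
      qed
      then show ?thesis by (simp add: mult_ac)
    qed
    show "summable (\<lambda>n. LINT z|sphere_measure. norm (f n z))"
      by (rule summable_comparison_test'[OF summable_mult2[OF summable_lap_coeff[OF c]]]) (rule bd)
  qed
  have "(LINT z|sphere_measure. lap_kernel c x z * Y z) = (LINT z|sphere_measure. (\<Sum>n. f n z))"
  proof (rule integral_cong_AE)
    have "continuous_on UNIV (\<lambda>z. lap_kernel c x z * Y z)"
      unfolding lap_kernel_def by (intro continuous_intros Yc)
    then show "(\<lambda>z. lap_kernel c x z * Y z) \<in> borel_measurable sphere_measure"
      by (auto dest: borel_measurable_continuous_onI)
    show "AE z in sphere_measure. lap_kernel c x z * Y z = (\<Sum>n. f n z)"
      using AE_sphere_measure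
    proof eventually_elim
      case (elim z)
      have "(\<lambda>n. lap_coeff c n * (x \<bullet> z) ^ n * Y z) sums (lap_kernel c x z * Y z)"
        using elim by (intro sums_mult2 lap_kernel_sums c x) simp
      then show ?case by (simp add: f_def sums_iff mult.assoc)
    qed
  qed measurable
  moreover have "(\<lambda>n. LINT z|sphere_measure. f n z) sums (?S * lap_eigen c ?d k * Y x)"
  proof -
    have "(LINT z|sphere_measure. f n z) = ?S * (lap_coeff c n * fh_coeff ?d n k) * Y x" for n
      unfolding f_def using funk_hecke_power[OF x d2 Y, of n] by simp
    moreover have "(\<lambda>n. ?S * (lap_coeff c n * fh_coeff ?d n k) * Y x) sums (?S * lap_eigen c ?d k * Y x)"
      unfolding lap_eigen_def by (intro sums_mult2 sums_mult summable_sums summable_lap_eigen c d1)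
    ultimately show ?thesis by simp
  qed
  ultimately show "(LINT z|sphere_measure. lap_kernel c x z * Y z) = ?S * lap_eigen c ?d k * Y x"
    using sums sums_unique2 by metis
qed

context harmonic_basis
begin

text \<open>On the diagonal all terms of the double series are nonnegative and it sums to \<open>\<Sum>n. lap_coeff c n\<close>;
  by AM-GM this dominates the off-diagonal double series, so the two summations may be exchanged.\<close>

lemma lap_kernel_expansion:
  fixes x z :: "real^'n"
  assumes c: "c > 0" and x: "norm x = 1" and z: "norm z = 1"
  shows "(\<lambda>k. measure (sphere_measure :: (real^'n) measure) UNIV * lap_eigen c (real CARD('n)) k *
    (\<Sum>j<N k. Y k j x * Y k j z)) sums lap_kernel c x z"
proof -
  let ?S = "measure (sphere_measure :: (real^'n) measure) UNIV" and ?d = "real CARD('n)"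
  let ?a = "lap_coeff c"
  have d1: "?d \<ge> 1" using d2 by simp
  define Z where "Z = (\<lambda>k x z. \<Sum>j<N k. Y k j x * Y k j z)"
  \<comment> \<open>Summing \<open>F\<close> over k gives the n-th Taylor term, a finite sum because
    degrees above n do not occur; summing over n gives the k-th term of the eigenvalue
    expansion.\<close>
  define F where "F = (\<lambda>x z (n, k). ?a n * (?S * fh_coeff ?d n k * Z k x z))"
  have w: "?a n \<ge> 0" "?S * fh_coeff ?d n k \<ge> 0" for n k
    using lap_coeff_pos[OF c, of n] d1 by (auto simp: fh_coeff_nonneg)
  have rows: "((\<lambda>k. F x z (n, k)) has_sum (?a n * (x \<bullet> z) ^ n)) UNIV" if "norm x = 1" "norm z = 1" for n x z
    by (rule has_sum_finite_neutralI[of "{..n}"])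
      (auto simp: F_def fh_coeff_def inner_power_expansion[OF that] Z_def sum_distrib_left)
  have Zp: "Z k x x \<ge> 0" for k x unfolding Z_def by (intro sum_nonneg) auto
  have Zle: "\<bar>Z k x z\<bar> \<le> (Z k x x + Z k z z) / 2" for k x z
  proof -
    have "\<bar>Z k x z\<bar> \<le> (\<Sum>j<N k. \<bar>Y k j x * Y k j z\<bar>)" unfolding Z_def by (rule sum_abs)
    also have "\<dots> \<le> (\<Sum>j<N k. (Y k j x * Y k j x + Y k j z * Y k j z) / 2)"
    proof (rule sum_mono)
      fix j
      have "0 \<le> (\<bar>Y k j x\<bar> - \<bar>Y k j z\<bar>)\<^sup>2" by simp
      then show "\<bar>Y k j x * Y k j z\<bar> \<le> (Y k j x * Y k j x + Y k j z * Y k j z) / 2"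
        by (simp add: power2_diff abs_mult power2_eq_square[symmetric])
    qed
    also have "\<dots> = (Z k x x + Z k z z) / 2" by (simp add: Z_def sum.distrib sum_divide_distrib[symmetric])
    finally show ?thesis .
  qed
  have diag: "F v v summable_on UNIV \<times> UNIV" if "norm v = 1" for v
  proof (rule summable_on_SigmaI)
    show "((\<lambda>k. F v v (n, k)) has_sum (?a n * (v \<bullet> v) ^ n)) UNIV" for n by (rule rows[OF that that])
    show "(\<lambda>n. ?a n * (v \<bullet> v) ^ n) summable_on UNIV"
      using that summable_lap_coeff[OF c] w(1) by (simp add: norm_eq_1 summable_on_UNIV_nonneg_real_iff)
    show "F v v (n, k) \<ge> 0" for n k using w Zp by (simp add: F_def)
  qed
  have "F x z summable_on UNIV \<times> UNIV"
  proof (rule abs_summable_summable, rule summable_on_comparison_test)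
    show "(\<lambda>p. F x x p + F z z p) summable_on UNIV \<times> UNIV"
      by (intro summable_on_add diag x z)
    fix p :: "nat \<times> nat"
    obtain n k where p: "p = (n, k)" by (cases p)
    have "norm (F x z p) = ?a n * (?S * fh_coeff ?d n k * \<bar>Z k x z\<bar>)"
      using w by (simp add: F_def p abs_mult d1 fh_coeff_nonneg)
    also have "\<dots> \<le> ?a n * (?S * fh_coeff ?d n k * (Z k x x + Z k z z))"
      using Zle[of k x z] Zp[of k x] Zp[of k z] by (intro mult_left_mono w) simp
    also have "\<dots> = F x x p + F z z p" by (simp add: F_def p algebra_simps)
    finally show "norm (F x z p) \<le> F x x p + F z z p" .
  qed simp
  then obtain s where s: "(F x z has_sum s) (UNIV \<times> UNIV)" by (auto simp: summable_on_def)
  have "((\<lambda>n. ?a n * (x \<bullet> z) ^ n) has_sum s) UNIV"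
    by (rule has_sum_SigmaD[OF s rows[OF x z]])
  then have "(\<lambda>n. ?a n * (x \<bullet> z) ^ n) sums s" by (rule has_sum_imp_sums)
  then have sK: "s = lap_kernel c x z" using lap_kernel_sums[OF c x z] sums_unique2 by blast
  have cols: "((\<lambda>n. F x z (n, k)) has_sum (?S * lap_eigen c ?d k * Z k x z)) UNIV" for k
  proof -
    have "(\<lambda>n. ?a n * fh_coeff ?d n k) sums lap_eigen c ?d k"
      unfolding lap_eigen_def by (intro summable_sums summable_lap_eigen c d1)
    then have "((\<lambda>n. ?a n * fh_coeff ?d n k) has_sum lap_eigen c ?d k) UNIV"
      using w(1) d1 by (intro sums_nonneg_imp_has_sum) (auto simp: fh_coeff_nonneg)
    from has_sum_cmult_right[OF this, of "?S * Z k x z"] show ?thesis by (simp add: F_def mult_ac)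
  qed
  have "((\<lambda>(k, n). F x z (n, k)) has_sum s) (UNIV \<times> UNIV)" using s by (subst (asm) has_sum_swap)
  from has_sum_SigmaD[OF this, of "\<lambda>k. ?S * lap_eigen c ?d k * Z k x z"] cols
  have "((\<lambda>k. ?S * lap_eigen c ?d k * Z k x z) has_sum s) UNIV" by simp
  then show ?thesis unfolding sK Z_def by (rule has_sum_imp_sums)
qed

end

theorem theorem3:
  fixes c :: real
  assumes d2: "CARD('n::finite) \<ge> 2"
    and c_pos: "c > 0"
  shows "\<exists>lam :: nat \<Rightarrow> real.
     (\<forall>k. mercer_eigenvalue (lap_kernel c :: real^'n \<Rightarrow> real^'n \<Rightarrow> real) k (lam k)) \<and>
     (\<forall>(N :: nat \<Rightarrow> nat) (Y :: nat \<Rightarrow> nat \<Rightarrow> real^'n \<Rightarrow> real).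
        (\<forall>k. sph_harm_onb k (N k) (Y k)) \<longrightarrow>
        (\<forall>x\<in>sphere 0 1. \<forall>z\<in>sphere 0 1.
           (\<lambda>k. lam k * (\<Sum>j<N k. Y k j x * Y k j z)) sums lap_kernel c x z)) \<and>
     (\<forall>k. lam k > 0) \<and>
     (\<exists>k0 B1 B2. B1 > 0 \<and> B2 > 0 \<and>
        (\<forall>k>k0. B1 * real k powr (- real CARD('n)) \<le> lam k \<and>
                lam k \<le> B2 * real k powr (- real CARD('n))))"
proof -
  let ?S = "measure (sphere_measure :: (real^'n) measure) UNIV" and ?d = "CARD('n)"
  have d1: "?d \<ge> 1" "real ?d \<ge> 1" using d2 by simp_all
  have S: "?S > 0" by (rule sphere_measure_pos)
  \<comment> \<open>\<open>lam\<close> depends on the kernel only, so one sequence serves every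
    basis; \<open>?S\<close> enters because the surface measure is not normalised.\<close>
  define lam where "lam = (\<lambda>k. ?S * lap_eigen c (real ?d) k)"
  have mercer: "mercer_eigenvalue (lap_kernel c :: real^'n \<Rightarrow> real^'n \<Rightarrow> real) k (lam k)" for k
    unfolding lam_def by (rule mercer_eigenvalue_lap_kernel[OF c_pos d2])
  have expansion: "(\<lambda>k. lam k * (\<Sum>j<N k. Y k j x * Y k j z)) sums lap_kernel c x z"
    if onb: "\<forall>k. sph_harm_onb k (N k) (Y k)" and "x \<in> sphere 0 1" "z \<in> sphere 0 1"
    for N and Y :: "nat \<Rightarrow> nat \<Rightarrow> real^'n \<Rightarrow> real" and x z
  proof -
    interpret harmonic_basis N Y using onb d2 by unfold_locales auto
    show ?thesis using lap_kernel_expansion[OF c_pos, of x z] that by (simp add: lam_def)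
  qed
  obtain B1 B2 where B: "B1 > 0" "B2 > 0"
    "\<And>k. k \<ge> 1 \<Longrightarrow> B1 / real k ^ ?d \<le> lap_eigen c (real ?d) k"
    "\<And>k. k \<ge> 1 \<Longrightarrow> lap_eigen c (real ?d) k \<le> B2 / real k ^ ?d"
    using lap_eigen_asymp[OF c_pos d1(1)] by blast
  \<comment> \<open>The bounds already hold from k = 1 on, so 0 can serve as
    \<open>k0\<close>.\<close>
  have asymp: "(?S * B1) * real k powr (- real ?d) \<le> lam k \<and> lam k \<le> (?S * B2) * real k powr (- real ?d)"
    if "k > 0" for k
  proof -
    have "real k powr (- real ?d) = 1 / real k ^ ?d"
      using that by (simp add: powr_minus powr_realpow divide_inverse)
    then show ?thesis using B(3,4)[of k] that S
        mult_left_mono[OF B(3)[of k], of ?S] mult_left_mono[OF B(4)[of k], of ?S]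
      by (simp add: lam_def)
  qed
  have "lam k > 0" for k using S lap_eigen_pos[OF c_pos d1(2)] by (simp add: lam_def)
  moreover have "?S * B1 > 0" "?S * B2 > 0" using S B by auto
  ultimately show ?thesis using mercer expansion asymp by (intro exI[of _ lam]) blast
qed

end
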